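(* Consider the semi-discrete (discrete in phase space, continuous in time) discontinuous Galerkin electromagnetic gyrokinetic system defined in the context, without collisions, sources or sinks, and with boundary conditions that are either periodic or such that the distribution function vanishes at the boundary. Then the discrete system conserves the discrete total energy $W_h=W_{H\,h}-W_{E\,h}+W_{B\,h}$, i.e. $\dfrac{dW_h}{dt}=0$, where $$W_{H\,h}=\sum_s\int_{\mathcal{T}}d\mathbf{R}\,d\mathbf{w}\ \mathcal{J}f_{s\,h}H_{s\,h},\qquad W_{E\,h}=\int_{\mathcal{T}^R}d\mathbf{R}\ \frac{\epsilon_\perp}{2}|\nabla_\perp\widetilde\phi_h|^2,\qquad W_{B\,h}=\int_{\mathcal{T}^R}d\mathbf{R}\ \frac{1}{2\mu_0}|\nabla_\perp A_{\parallel h}|^2 .$$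
   Context: **Phase space and notation.** Phase-space coordinates are $(\mathbf{R},v_\parallel,\mu)$ with $\mathbf{R}=(x,y,z)$ field-aligned coordinates ($x,y$ perpendicular, $z$ parallel to the background magnetic field $\mathbf{B}=B\hat{\mathbf{b}}$, time-independent). Species $s$ has charge $q_s$ and mass $m_s$. $d\mathbf{R}=dx\,dy\,dz$, $d\mathbf{w}=2\pi m_s^{-1}dv_\parallel\,d\mu$, and the Jacobian is $\mathcal{J}=B_\parallel^*\approx B$ (time-independent). The perpendicular gradient is $\nabla_\perp=\nabla-\hat{\mathbf{b}}(\hat{\mathbf{b}}\cdot\nabla)$. The Poisson bracket is $$\{F,G\}=\frac{\mathbf{B}^*}{m_sB_\parallel^*}\cdot\Big(\nabla F\frac{\partial G}{\partial v_\parallel}-\frac{\partial F}{\partial v_\parallel}\nabla G\Big)-\frac{\hat{\mathbf{b}}}{q_sB_\parallel^*}\times\nabla F\cdot\nabla G,$$ with $\mathbf{B}^*=\mathbf{B}+(m_sv_\parallel/q_s)\nabla\times\hat{\mathbf{b}}+\nabla A_{\parallel h}\times\hat{\mathbf{b}}$. **Mesh and spaces.** The phase-space domain is divided into a structured mesh $\mathcal{T}$ of finitely many cells $\mathcal{K}_j$. $\mathcal{V}_h^p$ is the space of functions whose restriction to each cell lies in a fixed polynomial space $\mathbf{P}^p$ of maximum degree $p\ge 1$ (serendipity elements), with no continuity required between cells. $\overline{\mathcal{V}}_h^p\subset\mathcal{V}_h^p$ is the subspace of functions continuous across all cell interfaces. $\mathcal{T}^R$ and $\mathcal{T}^v$ denote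 the restrictions of the mesh to configuration space and velocity space, and $\mathcal{X}_h^p$ is the restriction of $\mathcal{V}_h^p$ to configuration space. $\overline{\mathcal{X}}_h^p$, $\widetilde{\mathcal{X}}_h^p$, $\widehat{\mathcal{X}}_h^p$ are the subspaces of $\mathcal{X}_h^p$ of functions that are continuous, respectively, in all directions, in $x$ and $y$ only, and in $z$ only. **Discrete Hamiltonian and characteristics.** The Hamiltonian is $H_{s\,h}=\tfrac12 m_s v_{\parallel h}^2+\mu B_h+q_s\phi_h\in\overline{\mathcal{V}}_h^p$, where $v_{\parallel h}^2$ is the projection of $v_\parallel^2$ onto $\overline{\mathcal{V}}_h^p$, $B_h$ is the time-independent discrete field strength, and $\phi_h=\mathcal{P}_z[\widetilde\phi_h]\in\overline{\mathcal{X}}_h^p$ with $\widetilde\phi_h\in\widetilde{\mathcal{X}}_h^p$ the discrete potential; $\mathcal{P}_z$ is the (time-independent, linear) finite-element smoothing in $z$, i.e. $\phi_h=\mathcal P_z[\widetilde\phi_h]$ is determined by $\int\chi\,\phi_h\,d\mathbf{R}=\int\chi\,\widetilde\phi_h\,d\mathbf{R}$ for all $\chi\in\widehat{\mathcal{X}}_h^p$ (integrals global in $z$, cell-wise in $x,y$). The adjoint $\mathcal P_z^*$ is defined by $\int_{\mathcal{T}^R}f\,\mathcal{P}_z[g]\,d\mathbf{R}=\int_{\mathcal{T}^R}\mathcal{P}_z^*[f]\,g\,d\mathbf{R}$. The discrete parallel vector potential is $A_{\parallel h}\in\widetilde{\mathcal{X}}_h^p$. The characteristics are $\dot{\mathbf{R}}_h=\{\mathbf{R},H_{s\,h}\}$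 and $\dot v_{\parallel h}^H-\frac{q_s}{m_s}\frac{\partial A_{\parallel h}}{\partial t}$ with $\dot v^H_{\parallel h}=\{v_\parallel,H_{s\,h}\}$. The geometry is such that the components of the characteristics normal to cell interfaces are continuous across those interfaces. **Discrete gyrokinetic equation.** Without collisions and sources, $f_h=f_{s\,h}(t)\in\mathcal{V}_h^p$ satisfies, for each species $s$, each cell $\mathcal{K}_j$ and each test function $\psi\in\mathcal{V}_h^p$, $$\int_{\mathcal{K}_j}\!d\mathbf{R}\,d\mathbf{w}\,\psi\frac{\partial(\mathcal{J}f_h)}{\partial t}+\oint_{\partial\mathcal{K}_j}\!d\mathbf{w}\,d\mathbf{s}_R\cdot\dot{\mathbf{R}}_h\,\psi^-\widehat{\mathcal{J}f_h}+\oint_{\partial\mathcal{K}_j}\!d\mathbf{R}\,ds_w\Big(\dot v^H_{\parallel h}-\frac{q_s}{m_s}\frac{\partial A_{\parallel h}}{\partial t}\Big)\psi^-\widehat{\mathcal{J}f_h}$$ $$-\int_{\mathcal{K}_j}\!d\mathbf{R}\,d\mathbf{w}\,\mathcal{J}f_h\,\dot{\mathbf{R}}_h\cdot\nabla\psi-\int_{\mathcal{K}_j}\!d\mathbf{R}\,d\mathbf{w}\,\mathcal{J}f_h\Big(\dot v^H_{\parallel h}-\frac{q_s}{m_s}\frac{\partial A_{\parallel h}}{\partial t}\Big)\frac{\partial\psi}{\partial v_\parallel}=0 .$$ Here $d\mathbf{s}_R$ (resp. $ds_w$) is the outward-oriented surface element on configuration-space (resp. $v_\parallel$) faces of the cell,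 $\psi^-$ (resp. $\psi^+$) is the value just inside (resp. outside) the cell, and $\widehat{g}=\frac12(g^++g^-)-\frac12\,\mathrm{sgn}(\mathbf{n}\cdot\boldsymbol{\alpha}_h)(g^+-g^-)$ is the upwind numerical flux, with $\mathbf{n}$ the outward unit normal and $\boldsymbol\alpha_h$ the characteristic flow (or an approximation of it) used to decide the upwind direction; $\boldsymbol\alpha_h$ is the same seen from both sides of an interface, so $\widehat g$ takes a single value on each interface. **Discrete field equations.** With $\epsilon_\perp=\sum_s m_sn_{0s}/B^2$ ($n_{0s}$ constant in time), $\mu_0>0$ a constant, $\sigma_{g\,h}=\sum_sq_s\int_{\mathcal{T}^v}d\mathbf{w}\,\mathcal{J}f_{s\,h}$ and $J_{\parallel h}=\sum_s\frac{q_s}{m_s}\int_{\mathcal{T}^v}d\mathbf{w}\,\mathcal{J}\frac{\partial H_{s\,h}}{\partial v_\parallel}f_{s\,h}$, the fields satisfy at all times $$\int_{\mathcal{T}^R}\epsilon_\perp\nabla_\perp\widetilde\phi_h\cdot\nabla_\perp\xi\,d\mathbf{R}=\int_{\mathcal{T}^R}\xi\,\mathcal{P}_z^*[\sigma_{g\,h}]\,d\mathbf{R},\qquad\int_{\mathcal{T}^R}\nabla_\perp A_{\parallel h}\cdot\nabla_\perp\varphi\,d\mathbf{R}=\mu_0\int_{\mathcal{T}^R}\varphi\,J_{\parallel h}\,d\mathbf{R}$$ for all test functions $\xi,\varphi\in\widetilde{\mathcal{X}}_h^p$ (global-boundary surface terms vanish by the boundary conditions); $\partial A_{\parallel h}/\partial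 t\in\widetilde{\mathcal X}_h^p$ is determined by the time derivative of the second equation. All of $f_{s\,h},\widetilde\phi_h,A_{\parallel h}$ are continuously differentiable in time. **Boundary conditions.** In each direction they are either periodic (for all quantities) or such that the distribution function (hence the numerical flux) vanishes at the global boundary, so that all global-boundary surface terms vanish or cancel. *)

theory Defs
  imports "HOL-Analysis.Analysis"
begin

(* Points (R, v_par, mu) of phase space. Field-aligned coordinates R = (x,y,z) are R$1, R$2, R$3. *)
type_synonym conf_pt = "real ^ 3"
type_synonym phase_pt = "(real ^ 3) \<times> real \<times> real"

datatype dir = Conf 3 | Vpar | Mu

instance dir :: finite
proof
  have "(UNIV :: dir set) \<subseteq> range Conf \<union> {Vpar, Mu}"
    by (auto intro: dir.exhaust)
  then show "finite (UNIV :: dir set)"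
    by (rule finite_subset) simp
qed

definition coord :: "phase_pt \<Rightarrow> dir \<Rightarrow> real" where
  "coord z d = (case d of Conf i \<Rightarrow> fst z $ i | Vpar \<Rightarrow> fst (snd z) | Mu \<Rightarrow> snd (snd z))"

definition pt :: "(dir \<Rightarrow> real) \<Rightarrow> phase_pt" where
  "pt y = ((\<chi> i. y (Conf i)), y Vpar, y Mu)"

definition upd :: "phase_pt \<Rightarrow> dir \<Rightarrow> real \<Rightarrow> phase_pt" where
  "upd z d c = pt ((coord z)(d := c))"


subsection \<open>Structured mesh\<close>

text \<open>
  Along direction \<open>d\<close> the mesh has \<open>ncells M d\<close> intervals
  \<open>[nodes M d k, nodes M d (k+1)]\<close>; cells are products of such intervals. A function on the mesh
  that may jump between cells is a family with one (globally defined, polynomial) function per cell;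
  its one-sided traces on the cell boundary are then plain values of the member for that cell.
  A direction with \<open>periodic M d\<close> has its first and last cells glued.
\<close>

record mesh =
  nodes :: "dir \<Rightarrow> nat \<Rightarrow> real"
  ncells :: "dir \<Rightarrow> nat"
  periodic :: "dir \<Rightarrow> bool"

type_synonym conf_idx = "3 \<Rightarrow> nat"
type_synonym phase_idx = "dir \<Rightarrow> nat"
type_synonym conf_fam = "conf_idx \<Rightarrow> conf_pt \<Rightarrow> real"
type_synonym phase_fam = "phase_idx \<Rightarrow> phase_pt \<Rightarrow> real"

text \<open>
  There is no transport in \<open>\<mu>\<close>, and the Hamiltonian is affine in \<open>\<mu>\<close>, so that direction is never
  periodic.
\<close>

definition valid_mesh :: "mesh \<Rightarrow> bool" where
  "valid_mesh M \<longleftrightarrow>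
     (\<forall>d. 0 < ncells M d \<and> strict_mono_on {..ncells M d} (nodes M d)) \<and> \<not> periodic M Mu"

definition conf_idxs :: "mesh \<Rightarrow> conf_idx set" where
  "conf_idxs M = {k. \<forall>i. k i < ncells M (Conf i)}"

definition phase_idxs :: "mesh \<Rightarrow> phase_idx set" where
  "phase_idxs M = {j. \<forall>d. j d < ncells M d}"

definition conf_cell :: "mesh \<Rightarrow> conf_idx \<Rightarrow> conf_pt set" where
  "conf_cell M k =
     cbox (\<chi> i. nodes M (Conf i) (k i)) (\<chi> i. nodes M (Conf i) (Suc (k i)))"

definition vel_cell :: "mesh \<Rightarrow> phase_idx \<Rightarrow> (real \<times> real) set" where
  "vel_cell M j =
     {nodes M Vpar (j Vpar)..nodes M Vpar (Suc (j Vpar))} \<times>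
     {nodes M Mu (j Mu)..nodes M Mu (Suc (j Mu))}"

definition phase_cell :: "mesh \<Rightarrow> phase_idx \<Rightarrow> phase_pt set" where
  "phase_cell M j = conf_cell M (j \<circ> Conf) \<times> vel_cell M j"

definition conf_domain :: "mesh \<Rightarrow> conf_pt set" where
  "conf_domain M = (\<Union>k\<in>conf_idxs M. conf_cell M k)"

definition upper_nb :: "mesh \<Rightarrow> dir \<Rightarrow> phase_idx \<Rightarrow> phase_idx option" where
  "upper_nb M d j =
     (if Suc (j d) < ncells M d then Some (j(d := Suc (j d)))
      else if periodic M d then Some (j(d := 0)) else None)"

definition lower_nb :: "mesh \<Rightarrow> dir \<Rightarrow> phase_idx \<Rightarrow> phase_idx option" where
  "lower_nb M d j =
     (if 0 < j d then Some (j(d := j d - 1))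
      else if periodic M d then Some (j(d := ncells M d - 1)) else None)"

text \<open>
  Agreement of the two one-sided traces on every interface normal to \<open>d\<close>, periodic ones included.
  The point opposite to a point of the upper face of a cell has as its \<open>d\<close>-th coordinate the lower
  node of the neighbour; away from the periodic seam this is the same point.
\<close>

definition cont_dir :: "mesh \<Rightarrow> dir \<Rightarrow> phase_fam \<Rightarrow> bool" where
  "cont_dir M d F \<longleftrightarrow>
     (\<forall>j\<in>phase_idxs M. \<forall>j'. upper_nb M d j = Some j' \<longrightarrow>
        (\<forall>z\<in>phase_cell M j.
           F j (upd z d (nodes M d (Suc (j d)))) = F j' (upd z d (nodes M d (j' d)))))"


subsection \<open>Discrete spaces\<close>

text \<open>
  Serendipity space (Arnold--Awanou): spanned by the monomials of superlinear degree at most \<open>p\<close>,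
  i.e. of total degree at most \<open>p\<close> when variables entering linearly are not counted. The space is
  invariant under axis-parallel affine maps, so no reference cell is needed.
\<close>

definition superlinear_degree :: "(dir \<Rightarrow> nat) \<Rightarrow> nat" where
  "superlinear_degree e = (\<Sum>d\<in>UNIV. if 2 \<le> e d then e d else 0)"

definition serendipity :: "nat \<Rightarrow> (phase_pt \<Rightarrow> real) set" where
  "serendipity p =
     {F. \<exists>c. F = (\<lambda>z. \<Sum>e | superlinear_degree e \<le> p. c e * (\<Prod>d\<in>UNIV. coord z d ^ e d))}"

definition V_space :: "mesh \<Rightarrow> nat \<Rightarrow> phase_fam set" where
  "V_space M p = {F. \<forall>j\<in>phase_idxs M. F j \<in> serendipity p}"

definition V_cont :: "mesh \<Rightarrow> nat \<Rightarrow> phase_fam set" where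
  "V_cont M p = {F \<in> V_space M p. \<forall>d. cont_dir M d F}"

definition lift_conf :: "conf_fam \<Rightarrow> phase_fam" where
  "lift_conf F = (\<lambda>j z. F (j \<circ> Conf) (fst z))"

definition X_space :: "mesh \<Rightarrow> nat \<Rightarrow> conf_fam set" where
  "X_space M p = {F. lift_conf F \<in> V_space M p}"

definition X_cont :: "mesh \<Rightarrow> nat \<Rightarrow> conf_fam set" where
  "X_cont M p = {F \<in> X_space M p. \<forall>i. cont_dir M (Conf i) (lift_conf F)}"

definition X_cont_xy :: "mesh \<Rightarrow> nat \<Rightarrow> conf_fam set" where
  "X_cont_xy M p = {F \<in> X_space M p. \<forall>i\<in>{1, 2}. cont_dir M (Conf i) (lift_conf F)}"

definition X_cont_z :: "mesh \<Rightarrow> nat \<Rightarrow> conf_fam set" where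
  "X_cont_z M p = {F \<in> X_space M p. cont_dir M (Conf 3) (lift_conf F)}"


subsection \<open>Integrals\<close>

definition conf_int :: "mesh \<Rightarrow> conf_fam \<Rightarrow> real" where
  "conf_int M F = (\<Sum>k\<in>conf_idxs M. LINT R:conf_cell M k|lborel. F k R)"

text \<open>
  The following phase-space and velocity-space integrals use the measure
  \<open>dw = 2 \<pi> / m dv\<^sub>\<parallel> d\<mu>\<close>, with the species mass \<open>m\<close> as an argument.
\<close>

definition cell_int :: "mesh \<Rightarrow> real \<Rightarrow> phase_idx \<Rightarrow> (phase_pt \<Rightarrow> real) \<Rightarrow> real" where
  "cell_int M m j g = 2 * pi / m * (LINT z:phase_cell M j|lborel. g z)"

definition vel_int :: "mesh \<Rightarrow> real \<Rightarrow> phase_fam \<Rightarrow> conf_fam" where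
  "vel_int M m F k R =
     2 * pi / m * (\<Sum>j | j \<in> phase_idxs M \<and> j \<circ> Conf = k.
                     LINT w:vel_cell M j|lborel. F j (R, w))"

text \<open>Integral over the section at \<open>d\<close>-coordinate \<open>c\<close> of the cell \<open>j\<close>, in the other coordinates.\<close>

definition face_int :: "mesh \<Rightarrow> real \<Rightarrow> dir \<Rightarrow> phase_idx \<Rightarrow> real \<Rightarrow> (phase_pt \<Rightarrow> real) \<Rightarrow> real" where
  "face_int M m d j c g =
     2 * pi / m *
     (LINT y:PiE (- {d}) (\<lambda>e. {nodes M e (j e)..nodes M e (Suc (j e))})
        |PiM (- {d}) (\<lambda>_. lborel). g (pt (y(d := c))))"


subsection \<open>Geometry\<close>

text \<open>
  \<open>grad_coord G i\<close> is \<open>\<nabla>x\<close>, \<open>\<nabla>y\<close>, \<open>\<nabla>z\<close> for \<open>i = 1, 2, 3\<close>, as a vector of physical space; the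
  coordinates need not be orthogonal. Field alignment means that \<open>b\<close> is perpendicular to \<open>\<nabla>x\<close> and
  \<open>\<nabla>y\<close>.
\<close>

record geometry =
  Bmag :: "conf_pt \<Rightarrow> real"
  bhat :: "conf_pt \<Rightarrow> real ^ 3"
  grad_coord :: "3 \<Rightarrow> conf_pt \<Rightarrow> real ^ 3"

definition dconf :: "3 \<Rightarrow> (conf_pt \<Rightarrow> 'a::real_normed_vector) \<Rightarrow> conf_pt \<Rightarrow> 'a" where
  "dconf i F R = frechet_derivative F (at R) (axis i 1)"

definition grad :: "geometry \<Rightarrow> (conf_pt \<Rightarrow> real) \<Rightarrow> conf_pt \<Rightarrow> real ^ 3" where
  "grad G F R = (\<Sum>i\<in>UNIV. dconf i F R *\<^sub>R grad_coord G i R)"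

definition grad_perp :: "geometry \<Rightarrow> (conf_pt \<Rightarrow> real) \<Rightarrow> conf_pt \<Rightarrow> real ^ 3" where
  "grad_perp G F R = grad G F R - (bhat G R \<bullet> grad G F R) *\<^sub>R bhat G R"

definition curl_b :: "geometry \<Rightarrow> conf_pt \<Rightarrow> real ^ 3" where
  "curl_b G R = (\<Sum>i\<in>UNIV. cross3 (grad_coord G i R) (dconf i (bhat G) R))"

definition periodic_conf :: "mesh \<Rightarrow> (conf_pt \<Rightarrow> 'a) \<Rightarrow> bool" where
  "periodic_conf M u \<longleftrightarrow>
     (\<forall>i. periodic M (Conf i) \<longrightarrow>
        (\<forall>R\<in>conf_domain M.
           u (\<chi> k. if k = i then nodes M (Conf i) 0 else R $ k) =
           u (\<chi> k. if k = i then nodes M (Conf i) (ncells M (Conf i)) else R $ k)))"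

definition valid_geometry :: "mesh \<Rightarrow> geometry \<Rightarrow> bool" where
  "valid_geometry M G \<longleftrightarrow>
     continuous_on (conf_domain M) (Bmag G) \<and>
     (\<forall>i. continuous_on (conf_domain M) (grad_coord G i)) \<and>
     (\<forall>i. continuous_on (conf_domain M) (dconf i (bhat G))) \<and>
     (\<forall>R\<in>conf_domain M.
        0 < Bmag G R \<and> norm (bhat G R) = 1 \<and> bhat G differentiable (at R) \<and>
        bhat G R \<bullet> grad_coord G 1 R = 0 \<and> bhat G R \<bullet> grad_coord G 2 R = 0 \<and>
        grad_coord G 1 R \<bullet> cross3 (grad_coord G 2 R) (grad_coord G 3 R) \<noteq> 0) \<and>
     periodic_conf M (Bmag G) \<and> periodic_conf M (bhat G) \<and>
     (\<forall>i. periodic_conf M (grad_coord G i) \<and> periodic_conf M (dconf i (bhat G)))"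


subsection \<open>Discrete Hamiltonian and characteristics\<close>

record 's gk_setup =
  grid :: mesh
  geom :: geometry
  deg :: nat
  charge :: "'s \<Rightarrow> real"
  mass :: "'s \<Rightarrow> real"
  dens0 :: "'s \<Rightarrow> conf_pt \<Rightarrow> real"
  mu0 :: real
  vpar_sq :: phase_fam
  Bdisc :: conf_fam
  Pz :: "conf_fam \<Rightarrow> conf_fam"
  Pz_adj :: "conf_fam \<Rightarrow> conf_fam"

text \<open>
  \<open>upw U s t d\<close> is the \<open>d\<close>-component of the flow that decides the upwind direction.
\<close>

record 's gk_state =
  dist_fn :: "'s \<Rightarrow> real \<Rightarrow> phase_fam"
  pot :: "real \<Rightarrow> conf_fam"
  apar :: "real \<Rightarrow> conf_fam"
  upw :: "'s \<Rightarrow> real \<Rightarrow> dir \<Rightarrow> phase_fam"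

definition valid_species :: "'s::finite gk_setup \<Rightarrow> bool" where
  "valid_species S \<longleftrightarrow>
     (\<forall>s. charge S s \<noteq> 0 \<and> 0 < mass S s \<and>
          continuous_on (conf_domain (grid S)) (dens0 S s) \<and> periodic_conf (grid S) (dens0 S s))"

definition vpar_sq_projection :: "mesh \<Rightarrow> nat \<Rightarrow> phase_fam \<Rightarrow> bool" where
  "vpar_sq_projection M p F \<longleftrightarrow> F \<in> V_cont M p \<and>
     (\<forall>\<eta>\<in>V_cont M p.
        (\<Sum>j\<in>phase_idxs M. LINT z:phase_cell M j|lborel. \<eta> j z * F j z) =
        (\<Sum>j\<in>phase_idxs M. LINT z:phase_cell M j|lborel. \<eta> j z * (coord z Vpar)\<^sup>2))"

text \<open>Weak smoothing in \<open>z\<close>, column by column: \<open>a\<close> and \<open>b\<close> select a cell in \<open>x\<close> and \<open>y\<close>.\<close>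

definition z_smoothing :: "mesh \<Rightarrow> nat \<Rightarrow> (conf_fam \<Rightarrow> conf_fam) \<Rightarrow> bool" where
  "z_smoothing M p P \<longleftrightarrow>
     (\<forall>g\<in>X_space M p. P g \<in> X_cont_z M p \<and>
        (\<forall>\<eta>\<in>X_cont_z M p. \<forall>a < ncells M (Conf 1). \<forall>b < ncells M (Conf 2).
           (\<Sum>k | k \<in> conf_idxs M \<and> k 1 = a \<and> k 2 = b.
              LINT R:conf_cell M k|lborel. \<eta> k R * P g k R) =
           (\<Sum>k | k \<in> conf_idxs M \<and> k 1 = a \<and> k 2 = b.
              LINT R:conf_cell M k|lborel. \<eta> k R * g k R)))"

text \<open>
  The adjoint acts on arbitrary cellwise continuous functions, since the charge density, which
  contains the factor \<open>B\<close>, need not be piecewise polynomial.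
\<close>

definition z_adjoint :: "mesh \<Rightarrow> nat \<Rightarrow> (conf_fam \<Rightarrow> conf_fam) \<Rightarrow> (conf_fam \<Rightarrow> conf_fam) \<Rightarrow> bool" where
  "z_adjoint M p P Q \<longleftrightarrow>
     (\<forall>h. (\<forall>k\<in>conf_idxs M. continuous_on (conf_cell M k) (h k)) \<longrightarrow>
        Q h \<in> X_space M p \<and>
        (\<forall>g\<in>X_space M p. conf_int M (\<lambda>k R. h k R * P g k R) = conf_int M (\<lambda>k R. Q h k R * g k R)))"

definition dpar :: "(phase_pt \<Rightarrow> real) \<Rightarrow> phase_pt \<Rightarrow> real" where
  "dpar F z = deriv (\<lambda>v. F (fst z, v, snd (snd z))) (fst (snd z))"

definition dt :: "(real \<Rightarrow> 'i \<Rightarrow> 'p \<Rightarrow> real) \<Rightarrow> real \<Rightarrow> 'i \<Rightarrow> 'p \<Rightarrow> real" where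
  "dt F t j z = deriv (\<lambda>\<tau>. F \<tau> j z) t"

definition ham :: "'s gk_setup \<Rightarrow> 's gk_state \<Rightarrow> 's \<Rightarrow> real \<Rightarrow> phase_fam" where
  "ham S U s t j z =
     1 / 2 * mass S s * vpar_sq S j z + coord z Mu * Bdisc S (j \<circ> Conf) (fst z)
     + charge S s * Pz S (pot U t) (j \<circ> Conf) (fst z)"

definition Bstar :: "geometry \<Rightarrow> real \<Rightarrow> real \<Rightarrow> (conf_pt \<Rightarrow> real) \<Rightarrow> phase_pt \<Rightarrow> real ^ 3" where
  "Bstar G q m A z =
     (let R = fst z in
      Bmag G R *\<^sub>R bhat G R + (m * coord z Vpar / q) *\<^sub>R curl_b G R
      + cross3 (grad G A R) (bhat G R))"

text \<open>Here and in the Jacobian, \<open>B\<^sub>\<parallel>\<^sup>*\<close> is approximated by \<open>B\<close>.\<close>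

definition poisson_bracket ::
  "geometry \<Rightarrow> real \<Rightarrow> real \<Rightarrow> (conf_pt \<Rightarrow> real) \<Rightarrow>
   (phase_pt \<Rightarrow> real) \<Rightarrow> (phase_pt \<Rightarrow> real) \<Rightarrow> phase_pt \<Rightarrow> real" where
  "poisson_bracket G q m A F H z =
     (let R = fst z;
          gF = grad G (\<lambda>R'. F (R', snd z)) R;
          gH = grad G (\<lambda>R'. H (R', snd z)) R
      in (1 / (m * Bmag G R)) * (Bstar G q m A z \<bullet> (dpar H z *\<^sub>R gF - dpar F z *\<^sub>R gH))
         - (1 / (q * Bmag G R)) * (cross3 (bhat G R) gF \<bullet> gH))"

text \<open>Contravariant components \<open>{R\<^sup>i, H}\<close>.\<close>

definition Rdot :: "'s gk_setup \<Rightarrow> 's gk_state \<Rightarrow> 's \<Rightarrow> real \<Rightarrow> phase_idx \<Rightarrow> phase_pt \<Rightarrow> real ^ 3" where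
  "Rdot S U s t j z =
     (\<chi> i. poisson_bracket (geom S) (charge S s) (mass S s) (apar U t (j \<circ> Conf))
             (\<lambda>z'. fst z' $ i) (ham S U s t j) z)"

definition vdotH :: "'s gk_setup \<Rightarrow> 's gk_state \<Rightarrow> 's \<Rightarrow> real \<Rightarrow> phase_fam" where
  "vdotH S U s t j z =
     poisson_bracket (geom S) (charge S s) (mass S s) (apar U t (j \<circ> Conf))
       (\<lambda>z'. coord z' Vpar) (ham S U s t j) z"

definition vdot :: "'s gk_setup \<Rightarrow> 's gk_state \<Rightarrow> 's \<Rightarrow> real \<Rightarrow> phase_fam" where
  "vdot S U s t j z =
     vdotH S U s t j z - charge S s / mass S s * dt (apar U) t (j \<circ> Conf) (fst z)"

definition charac :: "'s gk_setup \<Rightarrow> 's gk_state \<Rightarrow> 's \<Rightarrow> real \<Rightarrow> dir \<Rightarrow> phase_fam" where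
  "charac S U s t d j z =
     (case d of Conf i \<Rightarrow> Rdot S U s t j z $ i | Vpar \<Rightarrow> vdot S U s t j z | Mu \<Rightarrow> 0)"

definition Jf :: "'s gk_setup \<Rightarrow> 's gk_state \<Rightarrow> 's \<Rightarrow> real \<Rightarrow> phase_fam" where
  "Jf S U s t j z = Bmag (geom S) (fst z) * dist_fn U s t j z"


subsection \<open>Discrete equations\<close>

text \<open>\<open>a\<close> is the outward normal component of the upwinding flow.\<close>

definition upwind :: "real \<Rightarrow> real \<Rightarrow> real \<Rightarrow> real" where
  "upwind a g_in g_out = 1 / 2 * (g_out + g_in) - 1 / 2 * sgn a * (g_out - g_in)"

text \<open>
  Numerical flux at a point \<open>z\<close> of the upper, respectively lower, face of cell \<open>j\<close> normal to \<open>d\<close>.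
  On the non-periodic part of the global boundary both arguments of the flux are the boundary value
  \<open>0\<close> of the distribution function, so the numerical flux vanishes. This covers the case that the
  inner trace of the polynomial itself vanishes there, without requiring it.
\<close>

definition upper_flux :: "mesh \<Rightarrow> dir \<Rightarrow> phase_fam \<Rightarrow> phase_fam \<Rightarrow> phase_fam" where
  "upper_flux M d a g j z =
     (case upper_nb M d j of
        None \<Rightarrow> upwind (a j z) 0 0
      | Some j' \<Rightarrow> upwind (a j z) (g j z) (g j' (upd z d (nodes M d (j' d)))))"

definition lower_flux :: "mesh \<Rightarrow> dir \<Rightarrow> phase_fam \<Rightarrow> phase_fam \<Rightarrow> phase_fam" where
  "lower_flux M d a g j z =
     (case lower_nb M d j of
        None \<Rightarrow> upwind (- a j z) 0 0
      | Some j' \<Rightarrow> upwind (- a j z) (g j z) (g j' (upd z d (nodes M d (Suc (j' d))))))"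

text \<open>Outward-oriented surface term over the two faces of cell \<open>j\<close> normal to \<open>d\<close>.\<close>

definition surface_term ::
  "'s gk_setup \<Rightarrow> 's gk_state \<Rightarrow> 's \<Rightarrow> real \<Rightarrow> phase_fam \<Rightarrow> phase_idx \<Rightarrow> dir \<Rightarrow> real" where
  "surface_term S U s t \<psi> j d =
     face_int (grid S) (mass S s) d j (nodes (grid S) d (Suc (j d)))
       (\<lambda>z. charac S U s t d j z * \<psi> j z
            * upper_flux (grid S) d (upw U s t d) (Jf S U s t) j z)
     - face_int (grid S) (mass S s) d j (nodes (grid S) d (j d))
       (\<lambda>z. charac S U s t d j z * \<psi> j z
            * lower_flux (grid S) d (upw U s t d) (Jf S U s t) j z)"

definition dg_equation :: "'s gk_setup \<Rightarrow> 's gk_state \<Rightarrow> 's \<Rightarrow> real \<Rightarrow> bool" where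
  "dg_equation S U s t \<longleftrightarrow>
     (\<forall>j\<in>phase_idxs (grid S). \<forall>\<psi>\<in>V_space (grid S) (deg S).
        cell_int (grid S) (mass S s) j (\<lambda>z. \<psi> j z * dt (Jf S U s) t j z)
        + (\<Sum>i\<in>UNIV. surface_term S U s t \<psi> j (Conf i))
        + surface_term S U s t \<psi> j Vpar
        - cell_int (grid S) (mass S s) j
            (\<lambda>z. Jf S U s t j z
                 * (\<Sum>i\<in>UNIV. Rdot S U s t j z $ i * dconf i (\<lambda>R. \<psi> j (R, snd z)) (fst z)))
        - cell_int (grid S) (mass S s) j
            (\<lambda>z. Jf S U s t j z * vdot S U s t j z * dpar (\<psi> j) z)
        = 0)"

definition eps_perp :: "'s::finite gk_setup \<Rightarrow> conf_pt \<Rightarrow> real" where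
  "eps_perp S R = (\<Sum>s\<in>UNIV. mass S s * dens0 S s R / (Bmag (geom S) R)\<^sup>2)"

definition sigma_g :: "'s::finite gk_setup \<Rightarrow> 's gk_state \<Rightarrow> real \<Rightarrow> conf_fam" where
  "sigma_g S U t k R =
     (\<Sum>s\<in>UNIV. charge S s * vel_int (grid S) (mass S s) (Jf S U s t) k R)"

definition J_par :: "'s::finite gk_setup \<Rightarrow> 's gk_state \<Rightarrow> real \<Rightarrow> conf_fam" where
  "J_par S U t k R =
     (\<Sum>s\<in>UNIV. charge S s / mass S s *
        vel_int (grid S) (mass S s)
          (\<lambda>j z. Bmag (geom S) (fst z) * dpar (ham S U s t j) z * dist_fn U s t j z) k R)"

definition poisson_equation :: "'s::finite gk_setup \<Rightarrow> 's gk_state \<Rightarrow> real \<Rightarrow> bool" where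
  "poisson_equation S U t \<longleftrightarrow>
     (\<forall>\<xi>\<in>X_cont_xy (grid S) (deg S).
        conf_int (grid S)
          (\<lambda>k R. eps_perp S R * (grad_perp (geom S) (pot U t k) R \<bullet> grad_perp (geom S) (\<xi> k) R)) =
        conf_int (grid S) (\<lambda>k R. \<xi> k R * Pz_adj S (sigma_g S U t) k R))"

definition ampere_equation :: "'s::finite gk_setup \<Rightarrow> 's gk_state \<Rightarrow> real \<Rightarrow> bool" where
  "ampere_equation S U t \<longleftrightarrow>
     (\<forall>\<phi>\<in>X_cont_xy (grid S) (deg S).
        conf_int (grid S)
          (\<lambda>k R. grad_perp (geom S) (apar U t k) R \<bullet> grad_perp (geom S) (\<phi> k) R) =
        mu0 S * conf_int (grid S) (\<lambda>k R. \<phi> k R * J_par S U t k R))"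

definition C1_in_time :: "'s gk_setup \<Rightarrow> 's gk_state \<Rightarrow> real set \<Rightarrow> bool" where
  "C1_in_time S U T \<longleftrightarrow>
     (\<forall>s. \<forall>j\<in>phase_idxs (grid S). \<forall>z\<in>phase_cell (grid S) j.
        (\<lambda>t. dist_fn U s t j z) C1_differentiable_on T) \<and>
     (\<forall>k\<in>conf_idxs (grid S). \<forall>R\<in>conf_cell (grid S) k.
        (\<lambda>t. pot U t k R) C1_differentiable_on T \<and>
        (\<lambda>t. apar U t k R) C1_differentiable_on T)"


subsection \<open>Discrete energy\<close>

definition W_H :: "'s::finite gk_setup \<Rightarrow> 's gk_state \<Rightarrow> real \<Rightarrow> real" where
  "W_H S U t =
     (\<Sum>s\<in>UNIV. \<Sum>j\<in>phase_idxs (grid S).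
        cell_int (grid S) (mass S s) j (\<lambda>z. Jf S U s t j z * ham S U s t j z))"

definition W_E :: "'s::finite gk_setup \<Rightarrow> 's gk_state \<Rightarrow> real \<Rightarrow> real" where
  "W_E S U t =
     conf_int (grid S) (\<lambda>k R. eps_perp S R / 2 * (norm (grad_perp (geom S) (pot U t k) R))\<^sup>2)"

definition W_B :: "'s gk_setup \<Rightarrow> 's gk_state \<Rightarrow> real \<Rightarrow> real" where
  "W_B S U t =
     conf_int (grid S) (\<lambda>k R. 1 / (2 * mu0 S) * (norm (grad_perp (geom S) (apar U t k) R))\<^sup>2)"

definition W_total :: "'s::finite gk_setup \<Rightarrow> 's gk_state \<Rightarrow> real \<Rightarrow> real" where
  "W_total S U t = W_H S U t - W_E S U t + W_B S U t"

end

theory Submission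
  imports Defs
begin

text \<open>
  Test the kinetic equation of each species with its Hamiltonian \<open>H\<close>, which is an admissible test
  function. The surface terms of adjacent cells cancel, since \<open>H\<close>, the normal characteristics and the
  numerical flux are single-valued on interfaces; the volume terms along the Hamiltonian part of the
  flow cancel because \<open>{H, H} = 0\<close>. What remains is the work of the inductive field on the parallel
  current, which by Ampere's law equals \<open>- dW\<^sub>B/dt\<close>.

  By adjointness and the Poisson equation, the charge density at time \<open>\<tau>\<close> and the smoothed potential
  at time \<open>\<tau>'\<close> have the interaction energy
  \<open>a(\<tau>, \<tau>') = \<integral> \<epsilon> \<nabla>\<phi>(\<tau>) \<bullet> \<nabla>\<phi>(\<tau>')\<close>, a symmetric form. Hence \<open>W\<^sub>H(\<tau>) - W\<^sub>E(\<tau>)\<close> is the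
  integral of \<open>J f(\<tau>) H(t)\<close>, with \<open>H\<close> frozen at time \<open>t\<close>, plus \<open>a(\<tau>, \<tau>)/2 - a(\<tau>, t)\<close>, which is stationary at
  \<open>\<tau> = t\<close>. So \<open>P\<^sub>z\<close> never has to be differentiated in time.

  Time derivatives are exchanged with integrals and gradients by writing a polynomial on a cell as
  a linear combination of fixed polynomials, with its values at finitely many points of the cell as
  coefficients.
\<close>

subsection \<open>Interpolation in finite-dimensional function spaces\<close>

definition fun_subspace :: "('a \<Rightarrow> real) set \<Rightarrow> bool" where
  "fun_subspace V \<longleftrightarrow> (\<lambda>_. 0) \<in> V \<and> (\<forall>f\<in>V. \<forall>g\<in>V. (\<lambda>x. f x + g x) \<in> V)
     \<and> (\<forall>c. \<forall>f\<in>V. (\<lambda>x. c * f x) \<in> V)"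

definition fun_span :: "'i set \<Rightarrow> ('i \<Rightarrow> 'a \<Rightarrow> real) \<Rightarrow> ('a \<Rightarrow> real) set" where
  "fun_span I m = {f. \<exists>c. f = (\<lambda>x. \<Sum>i\<in>I. c i * m i x)}"

lemma fun_span_subspace: "fun_subspace (fun_span I m)"
  unfolding fun_subspace_def
proof (intro conjI ballI allI)
  show "(\<lambda>_. 0) \<in> fun_span I m"
    by (auto simp: fun_span_def intro!: exI[of _ "\<lambda>_. 0"])
next
  fix f g assume "f \<in> fun_span I m" "g \<in> fun_span I m"
  then obtain c d where "f = (\<lambda>x. \<Sum>i\<in>I. c i * m i x)" "g = (\<lambda>x. \<Sum>i\<in>I. d i * m i x)"
    by (auto simp: fun_span_def)
  then show "(\<lambda>x. f x + g x) \<in> fun_span I m"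
    by (auto simp: fun_span_def sum.distrib ring_distribs intro!: exI[of _ "\<lambda>i. c i + d i"])
next
  fix a f assume "f \<in> fun_span I m"
  then obtain c where "f = (\<lambda>x. \<Sum>i\<in>I. c i * m i x)"
    by (auto simp: fun_span_def)
  then show "(\<lambda>x. a * f x) \<in> fun_span I m"
    by (auto simp: fun_span_def sum_distrib_left mult.assoc intro!: exI[of _ "\<lambda>i. a * c i"])
qed

lemma fun_span_base:
  assumes "finite I" "i \<in> I"
  shows "m i \<in> fun_span I m"
proof -
  have "m i = (\<lambda>x. \<Sum>i'\<in>I. (\<lambda>i'. if i' = i then 1 else 0) i' * m i' x)"
    using assms by (auto simp: if_distrib[of "\<lambda>c. c * _"] sum.delta cong: if_cong)
  then show ?thesis unfolding fun_span_def by (intro CollectI exI)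
qed

lemma fun_subspaceD:
  assumes "fun_subspace V"
  shows "(\<lambda>_. 0) \<in> V" "f \<in> V \<Longrightarrow> g \<in> V \<Longrightarrow> (\<lambda>x. f x + g x) \<in> V"
    "f \<in> V \<Longrightarrow> (\<lambda>x. c * f x) \<in> V" "f \<in> V \<Longrightarrow> g \<in> V \<Longrightarrow> (\<lambda>x. f x - g x) \<in> V"
proof -
  show "(\<lambda>x. f x - g x) \<in> V" if "f \<in> V" "g \<in> V"
  proof -
    have "(\<lambda>x. (-1) * g x) \<in> V" using assms that unfolding fun_subspace_def by metis
    then have "(\<lambda>x. f x + (\<lambda>x. (-1) * g x) x) \<in> V"
      using assms that(1) unfolding fun_subspace_def by metis
    then show ?thesis by simp
  qed
qed (use assms in \<open>auto simp: fun_subspace_def\<close>)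

lemma fun_subspace_sum:
  assumes V: "fun_subspace V" and "finite Z" "\<And>z. z \<in> Z \<Longrightarrow> l z \<in> V"
  shows "(\<lambda>x. \<Sum>z\<in>Z. c z * l z x) \<in> V"
  using assms(2,3)
  by (induction Z rule: finite_induct)
     (auto simp: fun_subspaceD[OF V])

definition interpolation :: "('a \<Rightarrow> real) set \<Rightarrow> 'a set \<Rightarrow> 'a set \<Rightarrow> ('a \<Rightarrow> 'a \<Rightarrow> real) \<Rightarrow> bool" where
  "interpolation V A Z l \<longleftrightarrow> finite Z \<and> Z \<subseteq> A \<and> (\<forall>z\<in>Z. l z \<in> V) \<and>
     (\<forall>f\<in>V. f = (\<lambda>x. \<Sum>z\<in>Z. f z * l z x))"

text \<open>Induction on the generators. For a new generator \<open>m b\<close>, consider its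
  interpolation residual \<open>r\<close>. If \<open>r\<close> vanishes on \<open>A\<close>, it
  vanishes identically by assumption and the old nodes suffice; otherwise a point of
  \<open>A\<close> with nonzero residual becomes a further node.\<close>

lemma interpolation_exists:
  assumes "finite I"
    and "\<And>f. f \<in> fun_span I m \<Longrightarrow> (\<And>x. x \<in> A \<Longrightarrow> f x = 0) \<Longrightarrow> f = (\<lambda>_. 0)"
  obtains Z l where "interpolation (fun_span I m) A Z l"
proof -
  \<comment> \<open>The Kronecker property strengthens the induction hypothesis: it makes
    interpolation exact at the nodes, so that the residual vanishes there
    (\<open>rZ\<close>).\<close>
  have "\<exists>Z l. interpolation (fun_span I m) A Z l \<and>
          (\<forall>z\<in>Z. \<forall>z'\<in>Z. l z z' = (if z = z' then 1 else 0))"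
    using assms
  proof (induction I rule: finite_induct)
    case empty
    show ?case
      by (rule exI[of _ "{}"]) (auto simp: interpolation_def fun_span_def)
  next
    case (insert b I)
    let ?V = "fun_span I m" and ?W = "fun_span (insert b I) m"
    note W = fun_subspaceD[OF fun_span_subspace[of "insert b I" m]]
    have sub: "f \<in> ?W" if f: "f \<in> ?V" for f
    proof -
      obtain c where "f = (\<lambda>x. \<Sum>i\<in>I. c i * m i x)"
        using f by (auto simp: fun_span_def)
      moreover have "(\<Sum>i\<in>I. c i * m i x) = (\<Sum>i\<in>insert b I. (c(b := 0)) i * m i x)" for x
        using insert.hyps by (auto intro!: sum.cong)
      ultimately show ?thesis unfolding fun_span_def by blast
    qed
    have dec: "\<exists>a. \<exists>g\<in>?V. f = (\<lambda>x. a * m b x + g x)" if f: "f \<in> ?W" for f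
    proof -
      obtain c where "f = (\<lambda>x. \<Sum>i\<in>insert b I. c i * m i x)"
        using f by (auto simp: fun_span_def)
      then have "f = (\<lambda>x. c b * m b x + (\<Sum>i\<in>I. c i * m i x))"
        using insert.hyps by simp
      moreover have "(\<lambda>x. \<Sum>i\<in>I. c i * m i x) \<in> ?V" unfolding fun_span_def by blast
      ultimately show ?thesis
        by (intro exI[of _ "c b"] bexI[of _ "\<lambda>x. \<Sum>i\<in>I. c i * m i x"])
    qed
    have mb: "m b \<in> ?W" using insert.hyps by (intro fun_span_base) auto
    obtain Z l where Z: "finite Z" "Z \<subseteq> A" "\<And>z. z \<in> Z \<Longrightarrow> l z \<in> ?V"
      and rep: "\<And>f. f \<in> ?V \<Longrightarrow> f = (\<lambda>x. \<Sum>z\<in>Z. f z * l z x)"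
      and delta: "\<And>z z'. z \<in> Z \<Longrightarrow> z' \<in> Z \<Longrightarrow> l z z' = (if z = z' then 1 else 0)"
    proof -
      have z: "f = (\<lambda>_. 0)" if "f \<in> ?V" "\<And>x. x \<in> A \<Longrightarrow> f x = 0" for f
        by (rule insert.prems[OF sub[OF that(1)] that(2)])
      from insert.IH[OF z] obtain Z l where *: "interpolation ?V A Z l"
        "\<forall>z\<in>Z. \<forall>z'\<in>Z. l z z' = (if z = z' then 1 else 0)" by blast
      then have "\<And>f. f \<in> ?V \<Longrightarrow> f = (\<lambda>x. \<Sum>z\<in>Z. f z * l z x)" by (simp add: interpolation_def)
      with * show ?thesis by (intro that[of Z l]) (auto simp: interpolation_def)
    qed
    define r where "r = (\<lambda>x. m b x - (\<Sum>z\<in>Z. m b z * l z x))"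
    have rZ: "r z = 0" if "z \<in> Z" for z
    proof -
      have "(\<Sum>w\<in>Z. m b w * l w z) = (\<Sum>w\<in>Z. if w = z then m b z else 0)"
        using delta that by (intro sum.cong) auto
      then show ?thesis using that Z(1) by (simp add: r_def sum.delta)
    qed
    have rW: "r \<in> ?W"
      unfolding r_def by (intro W(4) mb fun_subspace_sum[OF fun_span_subspace] Z(1) sub Z(3))
    show ?case
    proof (cases "\<forall>x\<in>A. r x = 0")
      case True
      then have r0: "r = (\<lambda>_. 0)" using insert.prems[OF rW] by blast
      have mbrep: "m b x = (\<Sum>z\<in>Z. m b z * l z x)" for x
        using fun_cong[OF r0, of x] unfolding r_def by linarith
      have "f = (\<lambda>x. \<Sum>z\<in>Z. f z * l z x)" if "f \<in> ?W" for f
      proof -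
        obtain a g where g: "g \<in> ?V" "f = (\<lambda>x. a * m b x + g x)" using dec[OF \<open>f \<in> ?W\<close>] by blast
        show ?thesis
        proof
          fix x
          have "(\<Sum>z\<in>Z. f z * l z x) = a * (\<Sum>z\<in>Z. m b z * l z x) + (\<Sum>z\<in>Z. g z * l z x)"
            by (simp add: g(2) sum_distrib_left sum.distrib algebra_simps)
          also have "\<dots> = f x" using mbrep[of x] fun_cong[OF rep[OF g(1)], of x] by (simp add: g(2))
          finally show "f x = (\<Sum>z\<in>Z. f z * l z x)" by simp
        qed
      qed
      then have "interpolation ?W A Z l"
        using Z sub by (simp add: interpolation_def)
      with delta show ?thesis by (intro exI[of _ Z] exI[of _ l]) simp
    next
      case False
      then obtain w where w: "w \<in> A" "r w \<noteq> 0" by blast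
      then have wZ: "w \<notin> Z" using rZ by auto
      \<comment> \<open>The residual scaled to the value 1 at \<open>w\<close> is the basis function
        of the new node. Subtracting multiples of it makes the old basis functions vanish at
        \<open>w\<close> and changes nothing at the old nodes, where \<open>lw\<close> is 0.\<close>
      define lw where "lw = (\<lambda>x. inverse (r w) * r x)"
      define l' where "l' = (\<lambda>z. if z = w then lw else (\<lambda>x. l z x - l z w * lw x))"
      have lwW: "lw \<in> ?W" unfolding lw_def by (intro W(3) rW)
      have l'W: "l' z \<in> ?W" if "z \<in> insert w Z" for z
        using that lwW sub Z(3) unfolding l'_def by (auto intro!: W(3,4))
      have lwdelta: "lw w = 1" "\<And>z. z \<in> Z \<Longrightarrow> lw z = 0"
        using w rZ by (auto simp: lw_def)
      have d: "l' z z' = (if z = z' then 1 else 0)"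
        if "z \<in> insert w Z" "z' \<in> insert w Z" for z z'
        using that delta lwdelta wZ unfolding l'_def by auto
      have "f = (\<lambda>x. \<Sum>z\<in>insert w Z. f z * l' z x)" if fW: "f \<in> ?W" for f
      proof
        fix x
        obtain a g where g: "g \<in> ?V" "f = (\<lambda>x. a * m b x + g x)" using dec[OF fW] by blast
        define h where "h = (\<lambda>x. \<Sum>z\<in>Z. f z * l z x)"
        \<comment> \<open>The component \<open>g\<close> is reproduced by its interpolant, so the
          interpolation error of \<open>f\<close> is \<open>a\<close> times that of
          \<open>m b\<close>.\<close>
        have fx: "f y = h y + a * r y" for y
        proof -
          have "h y = a * (\<Sum>z\<in>Z. m b z * l z y) + (\<Sum>z\<in>Z. g z * l z y)"
            by (simp add: h_def g(2) sum_distrib_left sum.distrib algebra_simps)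
          also have "(\<Sum>z\<in>Z. g z * l z y) = g y" using fun_cong[OF rep[OF g(1)], of y] by simp
          finally show ?thesis by (simp add: g(2) r_def algebra_simps)
        qed
        have "(\<Sum>z\<in>insert w Z. f z * l' z x) = f w * lw x + (\<Sum>z\<in>Z. f z * l' z x)"
          using Z(1) wZ by (simp add: l'_def)
        also have "(\<Sum>z\<in>Z. f z * l' z x) = (\<Sum>z\<in>Z. f z * l z x - f z * l z w * lw x)"
          using wZ by (intro sum.cong) (auto simp: l'_def algebra_simps)
        also have "\<dots> = h x - h w * lw x"
          by (simp add: h_def sum_subtractf sum_distrib_right)
        also have "f w * lw x + (h x - h w * lw x) = h x + a * r x"
          using w fx[of w] by (simp add: lw_def algebra_simps)
        finally show "f x = (\<Sum>z\<in>insert w Z. f z * l' z x)" using fx by simp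
      qed
      then have "interpolation ?W A (insert w Z) l'"
        using Z w l'W by (simp add: interpolation_def)
      with d show ?thesis by (intro exI[of _ "insert w Z"] exI[of _ l']) simp
    qed
  qed
  then show ?thesis using that by blast
qed

text \<open>\<open>F \<tau> x\<close> is a combination of the node values of \<open>F \<tau>\<close>
  with time-independent coefficients \<open>l z x\<close>. Differentiability in time on
  \<open>A\<close>, where the nodes lie, thus carries over to every \<open>x\<close>.\<close>

lemma interpolation_deriv:
  fixes F :: "real \<Rightarrow> 'a \<Rightarrow> real"
  assumes I: "interpolation V A Z l"
    and "open T" "t \<in> T" "\<And>\<tau>. \<tau> \<in> T \<Longrightarrow> F \<tau> \<in> V"
    and D: "\<And>z. z \<in> A \<Longrightarrow> (\<lambda>\<tau>. F \<tau> z) differentiable (at t)"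
  shows "((\<lambda>\<tau>. F \<tau> x) has_real_derivative (\<Sum>z\<in>Z. deriv (\<lambda>\<tau>. F \<tau> z) t * l z x)) (at t)"
proof -
  have "((\<lambda>\<tau>. \<Sum>z\<in>Z. F \<tau> z * l z x) has_real_derivative (\<Sum>z\<in>Z. deriv (\<lambda>\<tau>. F \<tau> z) t * l z x)) (at t)"
  proof (intro DERIV_sum DERIV_cmult_right)
    fix z assume "z \<in> Z"
    then have "(\<lambda>\<tau>. F \<tau> z) differentiable (at t)" using D I by (auto simp: interpolation_def)
    then show "((\<lambda>\<tau>. F \<tau> z) has_real_derivative deriv (\<lambda>\<tau>. F \<tau> z) t) (at t)"
      by (simp add: DERIV_deriv_iff_real_differentiable)
  qed
  moreover have "(\<Sum>z\<in>Z. F \<tau> z * l z x) = F \<tau> x" if "\<tau> \<in> T" for \<tau>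
  proof -
    have "F \<tau> = (\<lambda>x. \<Sum>z\<in>Z. F \<tau> z * l z x)"
      using I assms(4)[OF that] unfolding interpolation_def by blast
    then show ?thesis by metis
  qed
  ultimately show ?thesis
    by (rule has_field_derivative_transform_within_open[OF _ assms(2,3)])
qed

lemma interpolation_deriv_eq:
  fixes F :: "real \<Rightarrow> 'a \<Rightarrow> real"
  assumes "interpolation V A Z l"
    and "open T" "t \<in> T" "\<And>\<tau>. \<tau> \<in> T \<Longrightarrow> F \<tau> \<in> V"
    and "\<And>z. z \<in> A \<Longrightarrow> (\<lambda>\<tau>. F \<tau> z) differentiable (at t)"
  shows "(\<lambda>x. deriv (\<lambda>\<tau>. F \<tau> x) t) = (\<lambda>x. \<Sum>z\<in>Z. deriv (\<lambda>\<tau>. F \<tau> z) t * l z x)"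
  by (rule ext, rule DERIV_imp_deriv, rule interpolation_deriv[OF assms])

text \<open>Linearity is asked for on \<open>V\<close> only: the functionals in view are integrals,
  some of them of derivatives, and these are additive only for sufficiently regular
  functions.\<close>

definition linear_functional_on :: "('a \<Rightarrow> real) set \<Rightarrow> (('a \<Rightarrow> real) \<Rightarrow> real) \<Rightarrow> bool" where
  "linear_functional_on V L \<longleftrightarrow> (\<forall>f\<in>V. \<forall>g\<in>V. L (\<lambda>x. f x + g x) = L f + L g)
     \<and> (\<forall>c. \<forall>f\<in>V. L (\<lambda>x. c * f x) = c * L f)"

lemma linear_functional_on_sum:
  assumes V: "fun_subspace V" and L: "linear_functional_on V L"
    and "finite Z" "\<And>z. z \<in> Z \<Longrightarrow> l z \<in> V"
  shows "L (\<lambda>x. \<Sum>z\<in>Z. c z * l z x) = (\<Sum>z\<in>Z. c z * L (l z))"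
  using assms(3,4)
proof (induction Z rule: finite_induct)
  case empty
  have "\<forall>c. \<forall>f\<in>V. L (\<lambda>x. c * f x) = c * L f" using L by (simp add: linear_functional_on_def)
  from this[rule_format, OF fun_subspaceD(1)[OF V], of 0] show ?case by simp
next
  case (insert z Z)
  have "L (\<lambda>x. c z * l z x + (\<Sum>z\<in>Z. c z * l z x)) = L (\<lambda>x. c z * l z x) + L (\<lambda>x. \<Sum>z\<in>Z. c z * l z x)"
    using L fun_subspaceD(3)[OF V, of "l z" "c z"] fun_subspace_sum[OF V, of Z l c] insert
    unfolding linear_functional_on_def by auto
  also have "\<dots> = c z * L (l z) + (\<Sum>z\<in>Z. c z * L (l z))"
    using L insert unfolding linear_functional_on_def by simp
  finally show ?case using insert by simp
qed

text \<open>Differentiation under an integral without a domination argument: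
  \<open>L (F \<tau>)\<close> is a finite sum of node values of \<open>F \<tau>\<close> times the
  constants \<open>L (l z)\<close>.\<close>

lemma linear_functional_deriv:
  fixes F :: "real \<Rightarrow> 'a \<Rightarrow> real"
  assumes V: "fun_subspace V" and I: "interpolation V A Z l"
    and "open T" "t \<in> T" and FV: "\<And>\<tau>. \<tau> \<in> T \<Longrightarrow> F \<tau> \<in> V"
    and D: "\<And>z. z \<in> A \<Longrightarrow> (\<lambda>\<tau>. F \<tau> z) differentiable (at t)"
    and L: "linear_functional_on V L"
  shows "((\<lambda>\<tau>. L (F \<tau>)) has_real_derivative L (\<lambda>x. deriv (\<lambda>\<tau>. F \<tau> x) t)) (at t)"
proof -
  have Z: "finite Z" "\<And>z. z \<in> Z \<Longrightarrow> l z \<in> V" using I by (auto simp: interpolation_def)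
  have "((\<lambda>\<tau>. \<Sum>z\<in>Z. F \<tau> z * L (l z)) has_real_derivative (\<Sum>z\<in>Z. deriv (\<lambda>\<tau>. F \<tau> z) t * L (l z))) (at t)"
  proof (intro DERIV_sum DERIV_cmult_right)
    fix z assume "z \<in> Z"
    then have "(\<lambda>\<tau>. F \<tau> z) differentiable (at t)" using D I by (auto simp: interpolation_def)
    then show "((\<lambda>\<tau>. F \<tau> z) has_real_derivative deriv (\<lambda>\<tau>. F \<tau> z) t) (at t)"
      by (simp add: DERIV_deriv_iff_real_differentiable)
  qed
  moreover have "(\<Sum>z\<in>Z. F \<tau> z * L (l z)) = L (F \<tau>)" if "\<tau> \<in> T" for \<tau>
  proof -
    have "F \<tau> = (\<lambda>x. \<Sum>z\<in>Z. F \<tau> z * l z x)"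
      using I FV[OF that] unfolding interpolation_def by blast
    then have "L (F \<tau>) = L (\<lambda>x. \<Sum>z\<in>Z. F \<tau> z * l z x)" by (rule arg_cong)
    then show ?thesis
      using linear_functional_on_sum[OF V L Z, where c="F \<tau>"] by simp
  qed
  ultimately have "((\<lambda>\<tau>. L (F \<tau>)) has_real_derivative (\<Sum>z\<in>Z. deriv (\<lambda>\<tau>. F \<tau> z) t * L (l z))) (at t)"
    by (rule has_field_derivative_transform_within_open[OF _ assms(3,4)])
  moreover have "L (\<lambda>x. deriv (\<lambda>\<tau>. F \<tau> x) t) = (\<Sum>z\<in>Z. deriv (\<lambda>\<tau>. F \<tau> z) t * L (l z))"
    using arg_cong[OF interpolation_deriv_eq[OF I assms(3,4) FV D], of L]
      linear_functional_on_sum[OF V L Z, where c="\<lambda>z. deriv (\<lambda>\<tau>. F \<tau> z) t"]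
    by (rule trans)
  ultimately show ?thesis by simp
qed

lemma deriv_in_subspace:
  fixes F :: "real \<Rightarrow> 'a \<Rightarrow> real"
  assumes V: "fun_subspace V" and I: "interpolation V A Z l"
    and "open T" "t \<in> T" and FV: "\<And>\<tau>. \<tau> \<in> T \<Longrightarrow> F \<tau> \<in> V"
    and D: "\<And>z. z \<in> A \<Longrightarrow> (\<lambda>\<tau>. F \<tau> z) differentiable (at t)"
  shows "(\<lambda>x. deriv (\<lambda>\<tau>. F \<tau> x) t) \<in> V"
proof -
  have "(\<lambda>x. \<Sum>z\<in>Z. deriv (\<lambda>\<tau>. F \<tau> z) t * l z x) \<in> V"
    by (rule fun_subspace_sum[OF V]) (use I in \<open>auto simp: interpolation_def\<close>)
  also have "(\<lambda>x. \<Sum>z\<in>Z. deriv (\<lambda>\<tau>. F \<tau> z) t * l z x) = (\<lambda>x. deriv (\<lambda>\<tau>. F \<tau> x) t)"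
    by (rule interpolation_deriv_eq[OF I assms(3,4) FV D, symmetric])
  finally show ?thesis .
qed

text \<open>Expanding only the first argument over the nodes leaves products of a node value and
  \<open>B (l z) (F \<tau>)\<close>; by symmetry the latter is a linear functional of
  \<open>F \<tau>\<close>. The product rule gives two sums, and symmetry identifies both with the
  same value of \<open>B\<close>.\<close>

lemma symmetric_form_deriv:
  fixes F :: "real \<Rightarrow> 'a \<Rightarrow> real" and B :: "('a \<Rightarrow> real) \<Rightarrow> ('a \<Rightarrow> real) \<Rightarrow> real"
  assumes V: "fun_subspace V" and I: "interpolation V A Z l"
    and T: "open T" "t \<in> T" and FV: "\<And>\<tau>. \<tau> \<in> T \<Longrightarrow> F \<tau> \<in> V"
    and D: "\<And>z. z \<in> A \<Longrightarrow> (\<lambda>\<tau>. F \<tau> z) differentiable (at t)"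
    and L: "\<And>g. g \<in> V \<Longrightarrow> linear_functional_on V (\<lambda>f. B f g)"
    and sym: "\<And>f g. B f g = B g f"
  shows "((\<lambda>\<tau>. B (F \<tau>) (F \<tau>)) has_real_derivative 2 * B (\<lambda>x. deriv (\<lambda>\<tau>. F \<tau> x) t) (F t)) (at t)"
proof -
  let ?F' = "\<lambda>x. deriv (\<lambda>\<tau>. F \<tau> x) t"
  have F': "?F' \<in> V" by (rule deriv_in_subspace[OF V I T FV D])
  have Z: "finite Z" "\<And>z. z \<in> Z \<Longrightarrow> l z \<in> V" using I by (auto simp: interpolation_def)
  have rep: "f = (\<lambda>x. \<Sum>z\<in>Z. f z * l z x)" if "f \<in> V" for f
    using I that unfolding interpolation_def by blast
  have exp: "B f g = (\<Sum>z\<in>Z. f z * B (l z) g)" if "f \<in> V" "g \<in> V" for f g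
    using linear_functional_on_sum[OF V L[OF that(2)] Z, where c=f]
      arg_cong[OF rep[OF that(1)], of "\<lambda>f. B f g"] by simp
  have "((\<lambda>\<tau>. \<Sum>z\<in>Z. F \<tau> z * B (l z) (F \<tau>)) has_real_derivative
          (\<Sum>z\<in>Z. deriv (\<lambda>\<tau>. F \<tau> z) t * B (l z) (F t) + B (l z) ?F' * F t z)) (at t)"
  proof (intro DERIV_sum DERIV_mult)
    fix z assume z: "z \<in> Z"
    then have "(\<lambda>\<tau>. F \<tau> z) differentiable (at t)" using D I by (auto simp: interpolation_def)
    then show "((\<lambda>\<tau>. F \<tau> z) has_real_derivative deriv (\<lambda>\<tau>. F \<tau> z) t) (at t)"
      by (simp add: DERIV_deriv_iff_real_differentiable)
    have "((\<lambda>\<tau>. B (F \<tau>) (l z)) has_real_derivative B ?F' (l z)) (at t)"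
      by (rule linear_functional_deriv[OF V I T FV D L[OF Z(2)[OF z]]])
    then show "((\<lambda>\<tau>. B (l z) (F \<tau>)) has_real_derivative B (l z) ?F') (at t)"
      by (simp only: sym[of _ "l z"])
  qed
  moreover have "(\<Sum>z\<in>Z. deriv (\<lambda>\<tau>. F \<tau> z) t * B (l z) (F t) + B (l z) ?F' * F t z) = 2 * B ?F' (F t)"
    using exp[OF F' FV[OF T(2)]] exp[OF FV[OF T(2)] F'] sym[of "F t" ?F']
    by (simp add: sum.distrib mult.commute)
  ultimately have "((\<lambda>\<tau>. \<Sum>z\<in>Z. F \<tau> z * B (l z) (F \<tau>)) has_real_derivative 2 * B ?F' (F t)) (at t)"
    by simp
  then show ?thesis
    by (rule has_field_derivative_transform_within_open[OF _ T]) (use exp FV in auto)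
qed

subsection \<open>Polynomial functions\<close>

text \<open>Along the line through an interior point \<open>a\<close> of \<open>A\<close> and an
  arbitrary \<open>x\<close>, \<open>f\<close> is a polynomial in one variable that vanishes on a
  nonempty open set of parameters, hence at infinitely many. So it is zero, in particular at
  parameter 1, which is \<open>x\<close>.\<close>

lemma real_polynomial_function_zero:
  fixes f :: "'a::real_normed_vector \<Rightarrow> real"
  assumes f: "real_polynomial_function f" and "interior A \<noteq> {}"
    and zero: "\<And>x. x \<in> A \<Longrightarrow> f x = 0"
  shows "f = (\<lambda>_. 0)"
proof
  fix x
  obtain a where a: "a \<in> interior A" using assms(2) by blast
  define g where "g = (\<lambda>s::real. a + s *\<^sub>R (x - a))"
  have "polynomial_function g"
    unfolding g_def by (intro polynomial_function_add polynomial_function_const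
        polynomial_function_bounded_linear bounded_linear_scaleR_left)
  then have "real_polynomial_function (f \<circ> g)" using f by (rule real_polynomial_function_compose)
  then obtain c n where c: "f \<circ> g = (\<lambda>s. \<Sum>i\<le>n. c i * s ^ i)"
    by (auto simp: real_polynomial_function_iff_sum)
  have "continuous_on UNIV g" unfolding g_def by (intro continuous_intros)
  then have op: "open (g -` interior A)" by (intro open_vimage) auto
  have "0 \<in> g -` interior A" using a by (simp add: g_def)
  then have "infinite (g -` interior A)"
    using op finite_imp_not_open by blast
  moreover have "g -` interior A \<subseteq> {s. (\<Sum>i\<le>n. c i * s ^ i) = 0}"
    using zero interior_subset c by (force simp: fun_eq_iff o_def)
  ultimately have "\<not> finite {s. (\<Sum>i\<le>n. c i * s ^ i) = 0}" using finite_subset by blast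
  then have "\<forall>i\<le>n. c i = 0" using polyfun_finite_roots[of c n] by auto
  then have "(f \<circ> g) 1 = 0" by (simp add: c)
  then show "f x = 0" by (simp add: g_def)
qed

text \<open>Induction along the construction of polynomials. The second conjunct says that
  directional derivatives are polynomial again, which later supplies the continuity of
  gradients.\<close>

lemma real_polynomial_function_frechet:
  fixes f :: "'a::real_normed_vector \<Rightarrow> real"
  assumes "real_polynomial_function f"
  shows "\<exists>f'. (\<forall>x. (f has_derivative f' x) (at x)) \<and> (\<forall>v. real_polynomial_function (\<lambda>x. f' x v))"
  using assms
proof (induction f rule: real_polynomial_function.induct)
  case (linear f)
  then show ?case
    by (intro exI[of _ "\<lambda>_. f"]) (auto intro: bounded_linear_imp_has_derivative)
next
  case (const c)
  show ?case by (intro exI[of _ "\<lambda>_ _. 0"]) auto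
next
  case (add f g)
  then obtain f' g' where "\<forall>x. (f has_derivative f' x) (at x)" "\<forall>v. real_polynomial_function (\<lambda>x. f' x v)"
    "\<forall>x. (g has_derivative g' x) (at x)" "\<forall>v. real_polynomial_function (\<lambda>x. g' x v)" by blast
  then show ?case
    by (intro exI[of _ "\<lambda>x v. f' x v + g' x v"]) (auto intro: has_derivative_add)
next
  case (mult f g)
  then obtain f' g' where "\<forall>x. (f has_derivative f' x) (at x)" "\<forall>v. real_polynomial_function (\<lambda>x. f' x v)"
    "\<forall>x. (g has_derivative g' x) (at x)" "\<forall>v. real_polynomial_function (\<lambda>x. g' x v)" by blast
  with mult.hyps show ?case
    by (intro exI[of _ "\<lambda>x v. f x * g' x v + f' x v * g x"])
      (auto intro: has_derivative_mult intro!: Weierstrass_Theorems.real_polynomial_function.intros(3,4))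
qed

lemma real_polynomial_function_differentiable:
  "real_polynomial_function f \<Longrightarrow> f differentiable (at x)"
  using real_polynomial_function_frechet[of f] by (auto simp: differentiable_def)

lemma real_polynomial_function_frechet_derivative:
  assumes "real_polynomial_function f"
  shows "real_polynomial_function (\<lambda>x. frechet_derivative f (at x) v)"
proof -
  obtain f' where f': "\<And>x. (f has_derivative f' x) (at x)" "\<And>v. real_polynomial_function (\<lambda>x. f' x v)"
    using real_polynomial_function_frechet[OF assms] by blast
  then have "frechet_derivative f (at x) = f' x" for x
    using frechet_derivative_at by metis
  then show ?thesis using f'(2) by simp
qed

lemma real_polynomial_function_continuous_on:
  "real_polynomial_function f \<Longrightarrow> continuous_on A f"
  by (meson continuous_on_polymonial_function real_polynomial_function_eq)

subsection \<open>Discrete spaces on a mesh\<close>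

lemma UNIV_dir: "(UNIV :: dir set) = insert Vpar (insert Mu (range Conf))"
proof -
  have "d \<in> insert Vpar (insert Mu (range Conf))" for d by (cases d) auto
  then show ?thesis by blast
qed

lemma prod_dir:
  fixes g :: "dir \<Rightarrow> 'a::comm_monoid_mult"
  shows "(\<Prod>d\<in>UNIV. g d) = g Vpar * (g Mu * (\<Prod>i\<in>UNIV. g (Conf i)))"
proof -
  have "inj Conf" by (auto simp: inj_on_def)
  then show ?thesis
    by (subst UNIV_dir) (auto simp: prod.insert_if image_iff prod.reindex)
qed

definition monomial :: "(dir \<Rightarrow> nat) \<Rightarrow> phase_pt \<Rightarrow> real" where
  "monomial e z = (\<Prod>d\<in>UNIV. coord z d ^ e d)"

lemma finite_bounded_funs: "finite {e :: 'a::finite \<Rightarrow> nat. \<forall>d. e d < n d}"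
proof -
  have "{e :: 'a \<Rightarrow> nat. \<forall>d. e d < n d} = PiE UNIV (\<lambda>d. {..<n d})"
    by (auto simp: PiE_def)
  then show ?thesis by (simp add: finite_PiE)
qed

lemma finite_superlinear: "finite {e. superlinear_degree e \<le> p}"
proof (rule finite_subset)
  \<comment> \<open>An exponent below 2 is not counted in the superlinear degree, and a larger one
    is at most \<open>p\<close>; \<open>p + 2\<close> exceeds both.\<close>
  show "{e. superlinear_degree e \<le> p} \<subseteq> {e. \<forall>d. e d < p + 2}"
  proof (intro subsetI CollectI allI)
    fix e d assume e: "e \<in> {e. superlinear_degree e \<le> p}"
    have "(if 2 \<le> e d then e d else 0) \<le> superlinear_degree e"
      unfolding superlinear_degree_def by (rule member_le_sum) auto
    with e have "(if 2 \<le> e d then e d else 0) \<le> p" by simp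
    then show "e d < p + 2" by (auto split: if_splits)
  qed
qed (rule finite_bounded_funs)

lemma serendipity_eq: "serendipity p = fun_span {e. superlinear_degree e \<le> p} monomial"
  unfolding serendipity_def fun_span_def monomial_def ..

text \<open>Setting the velocity coordinates to 0 kills every monomial with a positive velocity
  exponent and, as \<open>0 ^ 0 = 1\<close>, leaves the others unchanged. So this is the span of the
  monomials in \<open>R\<close> alone, indexed by the same exponents as in phase space.\<close>

definition conf_serendipity :: "nat \<Rightarrow> (conf_pt \<Rightarrow> real) set" where
  "conf_serendipity p = fun_span {e. superlinear_degree e \<le> p} (\<lambda>e R. monomial e (R, 0, 0))"

lemma serendipity_subspace: "fun_subspace (serendipity p)" "fun_subspace (conf_serendipity p)"
  unfolding serendipity_eq conf_serendipity_def by (rule fun_span_subspace)+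

lemma conf_serendipityI:
  assumes "(\<lambda>z. f (fst z)) \<in> serendipity p"
  shows "f \<in> conf_serendipity p"
proof -
  obtain c where c: "(\<lambda>z. f (fst z)) = (\<lambda>z. \<Sum>e | superlinear_degree e \<le> p. c e * monomial e z)"
    using assms unfolding serendipity_eq fun_span_def by blast
  then have "f R = (\<Sum>e | superlinear_degree e \<le> p. c e * monomial e (R, 0, 0))" for R
    using fun_cong[OF c, of "(R, 0, 0)"] by simp
  then show ?thesis unfolding conf_serendipity_def fun_span_def by blast
qed

lemma monomial_split:
  "monomial e z = coord z Vpar ^ e Vpar * (coord z Mu ^ e Mu * (\<Prod>i\<in>UNIV. fst z $ i ^ e (Conf i)))"
  unfolding monomial_def prod_dir by (simp add: coord_def)

text \<open>A variable entering linearly does not count in the superlinear degree, so a monomial in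
  \<open>R\<close> alone may be multiplied by \<open>\<mu>\<close>. This puts the term
  \<open>\<mu> B\<close> of the Hamiltonian into the discrete space.\<close>

lemma Mu_mult_serendipity:
  assumes f: "(\<lambda>z. f (fst z)) \<in> serendipity p"
  shows "(\<lambda>z. coord z Mu * f (fst z)) \<in> serendipity p"
proof -
  let ?I = "{e. superlinear_degree e \<le> p}"
  note V = serendipity_subspace(1)[of p]
  obtain c where c: "f = (\<lambda>R. \<Sum>e\<in>?I. c e * monomial e (R, 0, 0))"
    using conf_serendipityI[OF f] unfolding conf_serendipity_def fun_span_def by blast
  have mem: "(\<lambda>z. coord z Mu * monomial e (fst z, 0, 0)) \<in> serendipity p" if e: "e \<in> ?I" for e
  proof (cases "e Vpar = 0 \<and> e Mu = 0")
    case True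
    have "coord z Mu * monomial e (fst z, 0, 0) = monomial (e(Mu := 1)) z" for z
      using True by (simp add: monomial_split coord_def)
    moreover have "superlinear_degree (e(Mu := 1)) \<le> superlinear_degree e"
      unfolding superlinear_degree_def by (rule sum_mono) auto
    then have "e(Mu := 1) \<in> ?I" using e by simp
    then have "monomial (e(Mu := 1)) \<in> serendipity p"
      unfolding serendipity_eq by (rule fun_span_base[OF finite_superlinear])
    ultimately show ?thesis by simp
  next
    case False
    then have "monomial e (fst z, 0, 0) = 0" for z :: phase_pt
      by (auto simp: monomial_split coord_def power_0_left)
    then show ?thesis using fun_subspaceD(1)[OF V] by simp
  qed
  have "(\<lambda>z. \<Sum>e\<in>?I. c e * (coord z Mu * monomial e (fst z, 0, 0))) \<in> serendipity p"
    by (rule fun_subspace_sum[OF V finite_superlinear mem])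
  also have "(\<lambda>z. \<Sum>e\<in>?I. c e * (coord z Mu * monomial e (fst z, 0, 0))) = (\<lambda>z. coord z Mu * f (fst z))"
    by (simp add: c sum_distrib_left algebra_simps)
  finally show ?thesis .
qed

lemma bounded_linear_coord: "bounded_linear (\<lambda>z. coord z d)"
  by (cases d) (auto simp: coord_def intro!: bounded_linear_compose[OF bounded_linear_vec_nth]
      bounded_linear_compose[OF bounded_linear_fst] bounded_linear_compose[OF bounded_linear_snd]
      bounded_linear_fst bounded_linear_snd)

lemma monomial_polynomial: "real_polynomial_function (monomial e)"
  unfolding monomial_def[abs_def]
  by (intro real_polynomial_function_prod real_polynomial_function_power
      real_polynomial_function.intros(1) bounded_linear_coord) simp

lemma serendipity_polynomial:
  assumes "f \<in> serendipity p"
  shows "real_polynomial_function f"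
proof -
  obtain c where c: "f = (\<lambda>z. \<Sum>e | superlinear_degree e \<le> p. c e * monomial e z)"
    using assms unfolding serendipity_eq fun_span_def by blast
  show ?thesis unfolding c
    by (intro real_polynomial_function_sum finite_superlinear real_polynomial_function.intros(4)
        real_polynomial_function.intros(2) monomial_polynomial)
qed

lemma conf_serendipity_polynomial:
  assumes "f \<in> conf_serendipity p"
  shows "real_polynomial_function f"
proof -
  obtain c where c: "f = (\<lambda>R. \<Sum>e | superlinear_degree e \<le> p. c e * monomial e (R, 0, 0))"
    using assms unfolding conf_serendipity_def fun_span_def by blast
  have "real_polynomial_function (\<lambda>R. monomial e (R, 0, 0))" for e
    unfolding monomial_def
  proof (intro real_polynomial_function_prod real_polynomial_function_power real_polynomial_function.intros(1))
    fix d
    have "bounded_linear (\<lambda>R :: conf_pt. (R, 0 :: real, 0 :: real))"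
      by (intro bounded_linear_Pair bounded_linear_ident bounded_linear_zero)
    from bounded_linear_compose[OF bounded_linear_coord this]
    show "bounded_linear (\<lambda>R. coord (R, 0, 0) d)" .
  qed simp
  then show ?thesis unfolding c
    by (intro real_polynomial_function_sum finite_superlinear real_polynomial_function.intros(4)
        real_polynomial_function.intros(2))
qed

section \<open>Mesh cells and interpolation of discrete functions on them\<close>

lemma compact_cells: "compact (conf_cell M k)" "compact (vel_cell M j)" "compact (phase_cell M j)"
  unfolding phase_cell_def conf_cell_def vel_cell_def by (auto intro!: compact_Times)

lemma vel_cell_eq:
  "vel_cell M j = cbox (nodes M Vpar (j Vpar), nodes M Mu (j Mu))
                    (nodes M Vpar (Suc (j Vpar)), nodes M Mu (Suc (j Mu)))"
  unfolding vel_cell_def by (simp add: cbox_Pair_eq)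

lemma finite_idxs: "finite (conf_idxs M)" "finite (phase_idxs M)"
  unfolding conf_idxs_def phase_idxs_def by (rule finite_bounded_funs)+

lemma phase_idxs_Conf: "j \<in> phase_idxs M \<Longrightarrow> j \<circ> Conf \<in> conf_idxs M"
  by (auto simp: phase_idxs_def conf_idxs_def)

lemma nodes_less:
  assumes "valid_mesh M" "n < ncells M d"
  shows "nodes M d n < nodes M d (Suc n)"
  using assms unfolding valid_mesh_def by (auto simp: strict_mono_on_def)

lemma interior_conf_cell:
  assumes "valid_mesh M" "k \<in> conf_idxs M"
  shows "interior (conf_cell M k) \<noteq> {}"
  using nodes_less[OF assms(1)] assms(2)
  unfolding conf_cell_def interior_cbox conf_idxs_def
  by (auto simp: box_ne_empty Basis_vec_def inner_axis)

lemma interior_phase_cell: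
  assumes "valid_mesh M" "j \<in> phase_idxs M"
  shows "interior (phase_cell M j) \<noteq> {}"
proof -
  have "nodes M d (j d) < nodes M d (Suc (j d))" for d
    using nodes_less[OF assms(1)] assms(2) unfolding phase_idxs_def by blast
  then show ?thesis
    using interior_conf_cell[OF assms(1) phase_idxs_Conf[OF assms(2)]]
    unfolding phase_cell_def vel_cell_def by (simp add: interior_Times less_le_not_le[symmetric] not_le)
qed

text \<open>A cell has nonempty interior, so a polynomial vanishing on it is zero. The nodes can
  therefore be taken in the cell, which is where \<open>C1_in_time\<close> provides
  derivatives.\<close>

lemma interpolation_phase:
  assumes "valid_mesh M" "j \<in> phase_idxs M"
  obtains Z l where "interpolation (serendipity p) (phase_cell M j) Z l"
proof (rule interpolation_exists[OF finite_superlinear])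
  fix f assume "f \<in> fun_span {e. superlinear_degree e \<le> p} monomial" "\<And>x. x \<in> phase_cell M j \<Longrightarrow> f x = 0"
  then show "f = (\<lambda>_. 0)"
    using real_polynomial_function_zero[OF serendipity_polynomial interior_phase_cell[OF assms]]
    unfolding serendipity_eq by blast
qed (use that serendipity_eq in auto)

lemma interpolation_conf:
  assumes "valid_mesh M" "k \<in> conf_idxs M"
  obtains Z l where "interpolation (conf_serendipity p) (conf_cell M k) Z l"
proof (rule interpolation_exists[OF finite_superlinear])
  fix f assume "f \<in> fun_span {e. superlinear_degree e \<le> p} (\<lambda>e R. monomial e (R, 0, 0))"
    "\<And>x. x \<in> conf_cell M k \<Longrightarrow> f x = 0"
  then show "f = (\<lambda>_. 0)"
    using real_polynomial_function_zero[OF conf_serendipity_polynomial interior_conf_cell[OF assms]]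
    unfolding conf_serendipity_def by blast
qed (use that conf_serendipity_def in auto)

lemma X_space_phase:
  assumes "F \<in> X_space M p" "j \<in> phase_idxs M"
  shows "(\<lambda>z. F (j \<circ> Conf) (fst z)) \<in> serendipity p"
  using assms unfolding X_space_def V_space_def lift_conf_def by auto

lemma X_space_conf:
  assumes M: "valid_mesh M" and F: "F \<in> X_space M p" and k: "k \<in> conf_idxs M"
  shows "F k \<in> conf_serendipity p"
proof -
  \<comment> \<open>Any phase-space cell above \<open>k\<close> will do, since the lift ignores
    velocity; index 0 is valid because every direction has at least one cell.\<close>
  define j where "j = (\<lambda>d. case d of Conf i \<Rightarrow> k i | _ \<Rightarrow> 0)"
  have "j \<in> phase_idxs M" unfolding phase_idxs_def
  proof (intro CollectI allI)
    fix d show "j d < ncells M d"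
      using k M by (cases d) (auto simp: j_def conf_idxs_def valid_mesh_def)
  qed
  moreover have "j \<circ> Conf = k" by (auto simp: j_def)
  ultimately show ?thesis using X_space_phase[OF F] conf_serendipityI by metis
qed

subsection \<open>Derivatives along coordinate axes\<close>

lemma frechet_section:
  fixes F :: "'a::real_normed_vector \<times> 'b::real_normed_vector \<Rightarrow> real"
  assumes "F differentiable (at (x, y))"
  shows "frechet_derivative (\<lambda>x'. F (x', y)) (at x) v = frechet_derivative F (at (x, y)) (v, 0)"
proof -
  have "(F has_derivative frechet_derivative F (at (x, y))) (at (x, y))"
    using assms frechet_derivative_works by blast
  moreover have "((\<lambda>x'. (x', y)) has_derivative (\<lambda>v. (v, 0))) (at x)"
    by (auto intro!: derivative_eq_intros)
  ultimately have "((\<lambda>x'. F (x', y)) has_derivative (\<lambda>v. frechet_derivative F (at (x, y)) (v, 0))) (at x)"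
    using has_derivative_compose[of "\<lambda>x'. (x', y)" "\<lambda>v. (v, 0)" x UNIV F] by auto
  from frechet_derivative_at[OF this] show ?thesis by metis
qed

text \<open>Turns a partial derivative at frozen velocity into a directional derivative of the whole
  polynomial, whose continuity is joint in all phase-space coordinates.\<close>

lemma dconf_phase:
  assumes "real_polynomial_function F"
  shows "dconf i (\<lambda>R. F (R, snd z)) (fst z) = frechet_derivative F (at z) (axis i 1, 0)"
  unfolding dconf_def
  using frechet_section[of F "fst z" "snd z"] real_polynomial_function_differentiable[OF assms] by simp

lemma dpar_phase:
  assumes "real_polynomial_function F"
  shows "dpar F z = frechet_derivative F (at z) (0, 1, 0)"
proof -
  obtain R v \<mu> where z: "z = (R, v, \<mu>)" by (cases z) auto
  let ?D = "frechet_derivative F (at z)"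
  have D: "(F has_derivative ?D) (at (R, v, \<mu>))"
    using real_polynomial_function_differentiable[OF assms, of z] frechet_derivative_works z by blast
  have "((\<lambda>v. (R, v, \<mu>)) has_derivative (\<lambda>h. (0, h, 0))) (at v)"
    by (auto intro!: derivative_eq_intros)
  with D have "((\<lambda>v. F (R, v, \<mu>)) has_derivative (\<lambda>h. ?D (0, h, 0))) (at v)"
    using has_derivative_compose[of "\<lambda>v. (R, v, \<mu>)" "\<lambda>h. (0, h, 0)" v UNIV F] by auto
  moreover have "?D (0, h, 0) = h * ?D (0, 1, 0)" for h
  proof -
    have "linear ?D" using D has_derivative_linear by blast
    from linear_scale[OF this, of h "(0, 1, 0)"] show ?thesis by simp
  qed
  ultimately have "((\<lambda>v. F (R, v, \<mu>)) has_field_derivative ?D (0, 1, 0)) (at v)"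
    unfolding has_field_derivative_def by (metis (no_types, lifting) ext mult.commute)
  then show ?thesis unfolding dpar_def z by (simp add: DERIV_imp_deriv)
qed

lemma continuous_on_dconf:
  "real_polynomial_function F \<Longrightarrow> continuous_on A (dconf i F)"
  unfolding dconf_def[abs_def]
  by (intro real_polynomial_function_continuous_on real_polynomial_function_frechet_derivative)

lemma dconf_add:
  "real_polynomial_function f \<Longrightarrow> real_polynomial_function g \<Longrightarrow>
    dconf i (\<lambda>x. f x + g x) R = dconf i f R + dconf i g R"
proof -
  assume "real_polynomial_function f" "real_polynomial_function g"
  then have "(f has_derivative frechet_derivative f (at R)) (at R)"
    "(g has_derivative frechet_derivative g (at R)) (at R)"
    using real_polynomial_function_differentiable frechet_derivative_works by blast+
  from has_derivative_add[OF this]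
  have "((\<lambda>x. f x + g x) has_derivative
      (\<lambda>v. frechet_derivative f (at R) v + frechet_derivative g (at R) v)) (at R)" .
  from frechet_derivative_at[OF this] show ?thesis unfolding dconf_def by metis
qed

lemma dconf_cmult:
  assumes "real_polynomial_function f"
  shows "dconf i (\<lambda>x. c * f x) R = c * dconf i f R"
proof -
  have "(f has_derivative frechet_derivative f (at R)) (at R)"
    using real_polynomial_function_differentiable[OF assms] frechet_derivative_works by blast
  then have "((\<lambda>x. c * f x) has_derivative (\<lambda>v. c * frechet_derivative f (at R) v)) (at R)"
    by (rule has_derivative_mult_right)
  from frechet_derivative_at[OF this] show ?thesis unfolding dconf_def by metis
qed

subsection \<open>Integrals over cells\<close>

lemma set_integrable_compact:
  fixes f :: "'a::euclidean_space \<Rightarrow> real"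
  assumes "compact K" "continuous_on K f"
  shows "set_integrable lborel K f"
  unfolding set_integrable_def using borel_integrable_compact[OF assms] by simp

text \<open>\<open>D\<close> produces the integrand from \<open>f\<close>: a weight times
  \<open>f\<close>, or a weighted product of its perpendicular gradient with a fixed one. Continuity
  on the compact set gives the integrability needed for additivity.\<close>

lemma linear_functional_integral:
  fixes D :: "('a \<Rightarrow> real) \<Rightarrow> 'b::euclidean_space \<Rightarrow> real"
  assumes "compact K" and "fun_subspace V"
    and cont: "\<And>f. f \<in> V \<Longrightarrow> continuous_on K (D f)"
    and add: "\<And>f g x. f \<in> V \<Longrightarrow> g \<in> V \<Longrightarrow> x \<in> K \<Longrightarrow> D (\<lambda>y. f y + g y) x = D f x + D g x"
    and scale: "\<And>c f x. f \<in> V \<Longrightarrow> x \<in> K \<Longrightarrow> D (\<lambda>y. c * f y) x = c * D f x"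
  shows "linear_functional_on V (\<lambda>f. LINT x:K|lborel. D f x)"
  unfolding linear_functional_on_def
proof (intro conjI ballI allI)
  have m: "K \<in> sets lborel" using assms(1) by (simp add: compact_imp_closed)
  fix f assume f: "f \<in> V"
  show "(LINT x:K|lborel. D (\<lambda>x. c * f x) x) = c * (LINT x:K|lborel. D f x)" for c
  proof -
    have "(LINT x:K|lborel. D (\<lambda>x. c * f x) x) = (LINT x:K|lborel. c * D f x)"
      using m scale[OF f] by (intro set_lebesgue_integral_cong) auto
    then show ?thesis by simp
  qed
  fix g assume g: "g \<in> V"
  have "(LINT x:K|lborel. D (\<lambda>x. f x + g x) x) = (LINT x:K|lborel. D f x + D g x)"
    using m add[OF f g] by (intro set_lebesgue_integral_cong) auto
  also have "\<dots> = (LINT x:K|lborel. D f x) + (LINT x:K|lborel. D g x)"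
    using set_integrable_compact[OF assms(1)] cont f g by (intro set_integral_add) auto
  finally show "(LINT x:K|lborel. D (\<lambda>x. f x + g x) x) = (LINT x:K|lborel. D f x) + (LINT x:K|lborel. D g x)" .
qed

lemma set_integral_Times:
  fixes f :: "'a::euclidean_space \<times> 'b::euclidean_space \<Rightarrow> real"
  assumes "compact A" "compact B" "continuous_on (A \<times> B) f"
  shows "(LINT z:A \<times> B|lborel. f z) = (LINT x:A|lborel. LINT y:B|lborel. f (x, y))"
proof -
  have "integrable lborel (\<lambda>z. indicator (A \<times> B) z *\<^sub>R f z)"
    using set_integrable_compact[OF compact_Times[OF assms(1,2)] assms(3)]
    by (simp add: set_integrable_def)
  then have "integrable (lborel \<Otimes>\<^sub>M lborel) (\<lambda>z. indicator (A \<times> B) z *\<^sub>R f z)"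
    by (simp add: lborel_prod)
  from lborel_pair.integral_fst'[OF this]
  have "(LINT z:A \<times> B|lborel. f z) = (\<integral>x. (\<integral>y. indicator (A \<times> B) (x, y) *\<^sub>R f (x, y) \<partial>lborel) \<partial>lborel)"
    by (simp add: set_lebesgue_integral_def lborel_prod)
  also have "\<dots> = (LINT x:A|lborel. LINT y:B|lborel. f (x, y))"
    by (simp add: set_lebesgue_integral_def indicator_times flip: Bochner_Integration.integral_mult_right_zero)
       (simp add: mult.assoc)
  finally show ?thesis .
qed

text \<open>Continuity in the parameter holds for the Henstock-Kurzweil integral, which agrees with
  the Lebesgue integral for continuous integrands on a box.\<close>

lemma continuous_on_section_integral:
  fixes f :: "'a::euclidean_space \<times> 'b::euclidean_space \<Rightarrow> real"
  assumes "continuous_on (A \<times> cbox a b) f"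
  shows "continuous_on A (\<lambda>x. LINT y:cbox a b|lborel. f (x, y))"
proof -
  have "continuous_on A (\<lambda>x. integral (cbox a b) (\<lambda>y. f (x, y)))"
    by (rule integral_continuous_on_param) (use assms in \<open>simp add: case_prod_beta'\<close>)
  moreover have "(LINT y:cbox a b|lborel. f (x, y)) = integral (cbox a b) (\<lambda>y. f (x, y))" if "x \<in> A" for x
    using that by (intro set_borel_integral_eq_integral(2) set_integrable_compact compact_cbox
        continuous_on_compose2[OF assms] continuous_intros) auto
  ultimately show ?thesis by (simp cong: continuous_on_cong)
qed

lemma continuous_on_vel_int:
  assumes "\<And>j. j \<in> phase_idxs M \<Longrightarrow> continuous_on (phase_cell M j) (F j)"
  shows "continuous_on (conf_cell M k) (vel_int M m F k)"
  unfolding vel_int_def[abs_def]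
proof (intro continuous_intros)
  fix j assume "j \<in> {j. j \<in> phase_idxs M \<and> j \<circ> Conf = k}"
  then have "continuous_on (conf_cell M k \<times> vel_cell M j) (F j)"
    using assms[of j] by (auto simp: phase_cell_def)
  then show "continuous_on (conf_cell M k) (\<lambda>R. LINT w:vel_cell M j|lborel. F j (R, w))"
    unfolding vel_cell_eq by (rule continuous_on_section_integral)
qed

text \<open>Fubini on each product cell, followed by regrouping: every phase-space cell lies over
  exactly one configuration-space cell. It converts the charge and current densities, as velocity
  moments, into phase-space integrals.\<close>

lemma conf_int_vel_int:
  assumes F: "\<And>j. j \<in> phase_idxs M \<Longrightarrow> continuous_on (phase_cell M j) (F j)"
    and h: "\<And>k. k \<in> conf_idxs M \<Longrightarrow> continuous_on (conf_cell M k) (h k)"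
  shows "conf_int M (\<lambda>k R. h k R * vel_int M m F k R) =
    (\<Sum>j\<in>phase_idxs M. cell_int M m j (\<lambda>z. h (j \<circ> Conf) (fst z) * F j z))"
proof -
  let ?J = "\<lambda>k. {j. j \<in> phase_idxs M \<and> j \<circ> Conf = k}"
  have "(LINT R:conf_cell M k|lborel. h k R * vel_int M m F k R) =
      (\<Sum>j\<in>?J k. cell_int M m j (\<lambda>z. h (j \<circ> Conf) (fst z) * F j z))" if k: "k \<in> conf_idxs M" for k
  proof -
    have c1: "continuous_on (conf_cell M k) (\<lambda>R. LINT w:vel_cell M j|lborel. F j (R, w))"
      and c2: "continuous_on (conf_cell M k \<times> vel_cell M j) (F j)" if "j \<in> ?J k" for j
    proof -
      show "continuous_on (conf_cell M k \<times> vel_cell M j) (F j)"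
        using F[of j] that by (auto simp: phase_cell_def)
      then show "continuous_on (conf_cell M k) (\<lambda>R. LINT w:vel_cell M j|lborel. F j (R, w))"
        unfolding vel_cell_eq by (rule continuous_on_section_integral)
    qed
    have "(LINT R:conf_cell M k|lborel. h k R * vel_int M m F k R) =
        (LINT R:conf_cell M k|lborel. \<Sum>j\<in>?J k. 2 * pi / m * (h k R * (LINT w:vel_cell M j|lborel. F j (R, w))))"
      by (simp add: vel_int_def sum_distrib_left algebra_simps)
    also have "\<dots> = (\<Sum>j\<in>?J k. LINT R:conf_cell M k|lborel. 2 * pi / m * (h k R * (LINT w:vel_cell M j|lborel. F j (R, w))))"
    proof -
      have "set_integrable lborel (conf_cell M k)
          (\<lambda>R. 2 * pi / m * (h k R * (LINT w:vel_cell M j|lborel. F j (R, w))))" if "j \<in> ?J k" for j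
        by (intro set_integrable_compact compact_cells continuous_intros h[OF k] c1[OF that])
      then show ?thesis
        unfolding set_lebesgue_integral_def[of lborel "conf_cell M k"] set_integrable_def scaleR_sum_right
        by (rule Bochner_Integration.integral_sum)
    qed
    also have "\<dots> = (\<Sum>j\<in>?J k. cell_int M m j (\<lambda>z. h (j \<circ> Conf) (fst z) * F j z))"
    proof (rule sum.cong[OF refl])
      fix j assume j: "j \<in> ?J k"
      have "continuous_on (conf_cell M k \<times> vel_cell M j) (\<lambda>z. h k (fst z) * F j z)"
        by (intro continuous_intros c2[OF j] continuous_on_compose2[OF h[OF k]]) auto
      from set_integral_Times[OF compact_cells(1,2) this]
      have "(LINT z:phase_cell M j|lborel. h k (fst z) * F j z) =
          (LINT R:conf_cell M k|lborel. h k R * (LINT w:vel_cell M j|lborel. F j (R, w)))"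
        using j unfolding phase_cell_def by auto
      then show "(LINT R:conf_cell M k|lborel. 2 * pi / m * (h k R * (LINT w:vel_cell M j|lborel. F j (R, w)))) =
          cell_int M m j (\<lambda>z. h (j \<circ> Conf) (fst z) * F j z)"
        using j by (simp add: cell_int_def)
    qed
    finally show ?thesis .
  qed
  then have "conf_int M (\<lambda>k R. h k R * vel_int M m F k R) =
      (\<Sum>k\<in>conf_idxs M. \<Sum>j\<in>?J k. cell_int M m j (\<lambda>z. h (j \<circ> Conf) (fst z) * F j z))"
    unfolding conf_int_def by (intro sum.cong) auto
  also have "\<dots> = (\<Sum>j\<in>phase_idxs M. cell_int M m j (\<lambda>z. h (j \<circ> Conf) (fst z) * F j z))"
    by (rule sum.group) (auto intro: finite_idxs phase_idxs_Conf)
  finally show ?thesis .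
qed

subsection \<open>Cancellation of the surface terms\<close>

lemma coord_pt [simp]: "coord (pt y) d = y d"
  by (cases d) (auto simp: coord_def pt_def)

lemma upd_pt: "upd (pt y) d c = pt (y(d := c))"
proof -
  have "coord (pt y) = y" by (rule ext) simp
  then show ?thesis by (simp add: upd_def)
qed

lemma coord_upd: "coord (upd z d c) e = (if e = d then c else coord z e)"
  unfolding upd_def by simp

lemma fst_upd_Vpar: "fst (upd z Vpar c) = fst z"
  by (auto simp: upd_def pt_def coord_def vec_eq_iff)

lemma pt_in_phase_cell:
  "pt y \<in> phase_cell M j \<longleftrightarrow> (\<forall>d. y d \<in> {nodes M d (j d)..nodes M d (Suc (j d))})"
proof
  assume "pt y \<in> phase_cell M j"
  then have h: "\<And>i. y (Conf i) \<in> {nodes M (Conf i) (j (Conf i))..nodes M (Conf i) (Suc (j (Conf i)))}"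
    "y Vpar \<in> {nodes M Vpar (j Vpar)..nodes M Vpar (Suc (j Vpar))}"
    "y Mu \<in> {nodes M Mu (j Mu)..nodes M Mu (Suc (j Mu))}"
    by (auto simp: pt_def phase_cell_def conf_cell_def vel_cell_def mem_box_cart)
  show "\<forall>d. y d \<in> {nodes M d (j d)..nodes M d (Suc (j d))}"
  proof
    fix d show "y d \<in> {nodes M d (j d)..nodes M d (Suc (j d))}"
      by (cases d) (use h in auto)
  qed
qed (auto simp: pt_def phase_cell_def conf_cell_def vel_cell_def mem_box_cart)

lemma upper_nb_SomeD:
  assumes "j \<in> phase_idxs M" "upper_nb M d j = Some j'"
  shows "j' \<in> phase_idxs M" "lower_nb M d j' = Some j" "\<And>e. e \<noteq> d \<Longrightarrow> j' e = j e"
proof -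
  have lt: "j e < ncells M e" for e using assms(1) by (simp add: phase_idxs_def)
  have "0 < ncells M d" by (rule le_less_trans[OF le0 lt])
  then show "j' \<in> phase_idxs M" "\<And>e. e \<noteq> d \<Longrightarrow> j' e = j e"
    using assms(2) lt by (auto simp: upper_nb_def phase_idxs_def split: if_splits)
  \<comment> \<open>Without a next cell the index is the last one, which is what
    \<open>lower_nb\<close> assigns to cell 0 across the periodic seam.\<close>
  have "j d = ncells M d - Suc 0" if "\<not> Suc (j d) < ncells M d" using lt[of d] that by linarith
  then show "lower_nb M d j' = Some j"
    using assms(2) by (auto simp: upper_nb_def lower_nb_def fun_upd_idem split: if_splits)
qed

lemma lower_nb_SomeD:
  assumes "j \<in> phase_idxs M" "lower_nb M d j = Some j'"
  shows "j' \<in> phase_idxs M" "upper_nb M d j' = Some j"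
proof -
  have lt: "j e < ncells M e" for e using assms(1) by (simp add: phase_idxs_def)
  then have lt': "j d - n < ncells M d" "ncells M d - Suc 0 < ncells M d" for n
    using less_imp_diff_less[OF lt[of d]] le_less_trans[OF le0 lt[of d]] by auto
  show "j' \<in> phase_idxs M"
    using assms(2) lt lt' by (auto simp: lower_nb_def phase_idxs_def split: if_splits)
  \<comment> \<open>Truncated subtraction is exact here, as there is at least one cell; hence the
    step up from the last cell wraps around to cell 0.\<close>
  have "Suc (ncells M d - Suc 0) = ncells M d" using lt[of d] by linarith
  then show "upper_nb M d j' = Some j"
    using assms(2) lt by (auto simp: upper_nb_def lower_nb_def fun_upd_idem split: if_splits)
qed

text \<open>Seen from the neighbour, the outward normal changes sign and the inner and outer values
  exchange roles. Both changes of sign compensate in the jump term, so the numerical flux is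
  single-valued.\<close>

lemma upwind_swap: "upwind (- a) y x = upwind a x y"
  by (simp add: upwind_def sgn_minus field_simps)

text \<open>Compares faces of two cells with equal transversal intervals. The coordinates
  \<open>c\<close> and \<open>c'\<close> along \<open>d\<close> are kept apart because they differ
  at a periodic seam.\<close>

lemma face_int_cong:
  assumes "\<And>e. e \<noteq> d \<Longrightarrow> j' e = j e"
    and "\<And>y. (\<And>e. e \<noteq> d \<Longrightarrow> y e \<in> {nodes M e (j e)..nodes M e (Suc (j e))}) \<Longrightarrow>
      g (pt (y(d := c))) = g' (pt (y(d := c')))"
  shows "face_int M m d j c g = face_int M m d j' c' g'"
proof -
  have "PiE (- {d}) (\<lambda>e. {nodes M e (j' e)..nodes M e (Suc (j' e))}) =
        PiE (- {d}) (\<lambda>e. {nodes M e (j e)..nodes M e (Suc (j e))})"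
    using assms(1) by (intro PiE_cong) auto
  moreover have "g (pt (y(d := c))) = g' (pt (y(d := c')))"
    if "y \<in> PiE (- {d}) (\<lambda>e. {nodes M e (j e)..nodes M e (Suc (j e))})" for y
    using that by (intro assms(2)) (auto simp: PiE_iff)
  ultimately show ?thesis
    unfolding face_int_def set_lebesgue_integral_def
    by (auto intro!: Bochner_Integration.integral_cong simp: indicator_def)
qed

text \<open>The contribution of an upper face equals that of the lower face of the upper neighbour,
  where it is subtracted: characteristic, test function and numerical flux all agree there. Faces
  without a neighbour carry no flux.\<close>

lemma sum_surface_term:
  assumes M: "valid_mesh (grid S)" and \<psi>: "cont_dir (grid S) d \<psi>"
    and charac: "cont_dir (grid S) d (charac S U s t d)"
    and upw: "cont_dir (grid S) d (upw U s t d)"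
  shows "(\<Sum>j\<in>phase_idxs (grid S). surface_term S U s t \<psi> j d) = 0"
proof -
  let ?M = "grid S" and ?a = "upw U s t d" and ?g = "Jf S U s t" and ?c = "charac S U s t d"
  define Up where "Up j = face_int ?M (mass S s) d j (nodes ?M d (Suc (j d)))
       (\<lambda>z. ?c j z * \<psi> j z * upper_flux ?M d ?a ?g j z)" for j
  define Lo where "Lo j = face_int ?M (mass S s) d j (nodes ?M d (j d))
       (\<lambda>z. ?c j z * \<psi> j z * lower_flux ?M d ?a ?g j z)" for j
  \<comment> \<open>On the non-periodic global boundary both arguments of the flux are 0, and so is
    the flux.\<close>
  have Up0: "Up j = 0" if "upper_nb ?M d j = None" for j
    using that by (simp add: Up_def upper_flux_def upwind_def face_int_def)
  have Lo0: "Lo j = 0" if "lower_nb ?M d j = None" for j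
    using that by (simp add: Lo_def lower_flux_def upwind_def face_int_def)
  have UpLo: "Up j = Lo j'" if j: "j \<in> phase_idxs ?M" and nb: "upper_nb ?M d j = Some j'" for j j'
    unfolding Up_def Lo_def
  proof (rule face_int_cong)
    show "j' e = j e" if "e \<noteq> d" for e by (rule upper_nb_SomeD(3)[OF j nb that])
    fix y assume y: "\<And>e. e \<noteq> d \<Longrightarrow> y e \<in> {nodes ?M e (j e)..nodes ?M e (Suc (j e))}"
    let ?z = "pt (y(d := nodes ?M d (Suc (j d))))" and ?z' = "pt (y(d := nodes ?M d (j' d)))"
    \<comment> \<open>\<open>cont_dir\<close> speaks of points of the cell whose
      \<open>d\<close>-coordinate is then overwritten. Any such coordinate in the cell serves for
      \<open>x\<close>; the lower node is taken.\<close>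
    obtain x where x: "x \<in> phase_cell ?M j" "\<And>c. upd x d c = pt (y(d := c))"
    proof (rule that[of "pt (y(d := nodes ?M d (j d)))"])
      have "nodes ?M d (j d) < nodes ?M d (Suc (j d))"
        using j by (intro nodes_less[OF M]) (simp add: phase_idxs_def)
      then show "pt (y(d := nodes ?M d (j d))) \<in> phase_cell ?M j"
        using y by (auto simp: pt_in_phase_cell)
    qed (simp add: upd_pt)
    have tr: "F j ?z = F j' ?z'" if "cont_dir ?M d F" for F
    proof -
      have "F j (upd x d (nodes ?M d (Suc (j d)))) = F j' (upd x d (nodes ?M d (j' d)))"
        using that j nb x(1) unfolding cont_dir_def by blast
      then show ?thesis by (simp add: x(2))
    qed
    show "?c j ?z * \<psi> j ?z * upper_flux ?M d ?a ?g j ?z = ?c j' ?z' * \<psi> j' ?z' * lower_flux ?M d ?a ?g j' ?z'"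
      by (simp add: upper_flux_def lower_flux_def nb upper_nb_SomeD(2)[OF j nb] upd_pt upwind_swap
          tr[OF \<psi>] tr[OF charac] tr[OF upw])
  qed
  \<comment> \<open>Passing to the upper neighbour is a bijection from the cells that have one onto
    the cells that have a lower neighbour.\<close>
  let ?A = "{j \<in> phase_idxs ?M. upper_nb ?M d j \<noteq> None}" and ?B = "{j \<in> phase_idxs ?M. lower_nb ?M d j \<noteq> None}"
  have "(\<Sum>j\<in>phase_idxs ?M. Up j) = (\<Sum>j\<in>?A. Up j)"
    by (rule sum.mono_neutral_right[OF finite_idxs(2)]) (use Up0 in auto)
  also have "\<dots> = (\<Sum>j\<in>?B. Lo j)"
  proof (rule sum.reindex_bij_witness[where i = "\<lambda>j. the (lower_nb ?M d j)" and j = "\<lambda>j. the (upper_nb ?M d j)"])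
    fix j assume "j \<in> ?A"
    then obtain j' where j: "j \<in> phase_idxs ?M" and nb: "upper_nb ?M d j = Some j'" by auto
    note up = upper_nb_SomeD(1,2)[OF j nb]
    show "the (lower_nb ?M d (the (upper_nb ?M d j))) = j" "the (upper_nb ?M d j) \<in> ?B"
      "Lo (the (upper_nb ?M d j)) = Up j"
      using up UpLo[OF j nb] nb by simp_all
  next
    fix j assume "j \<in> ?B"
    then obtain j' where j: "j \<in> phase_idxs ?M" and nb: "lower_nb ?M d j = Some j'" by auto
    show "the (upper_nb ?M d (the (lower_nb ?M d j))) = j" "the (lower_nb ?M d j) \<in> ?A"
      using lower_nb_SomeD[OF j nb] nb by simp_all
  qed
  also have "\<dots> = (\<Sum>j\<in>phase_idxs ?M. Lo j)"
    by (rule sum.mono_neutral_left[OF finite_idxs(2)]) (use Lo0 in auto)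
  finally have "(\<Sum>j\<in>phase_idxs ?M. Up j) = (\<Sum>j\<in>phase_idxs ?M. Lo j)" .
  then show ?thesis
    unfolding surface_term_def Up_def[symmetric] Lo_def[symmetric] by (simp add: sum_subtractf)
qed

lemma cont_dir_lift_Vpar: "cont_dir M Vpar (lift_conf F)"
  unfolding cont_dir_def
proof (intro ballI allI impI)
  fix j j' z assume j: "j \<in> phase_idxs M" "upper_nb M Vpar j = Some j'"
  have "j' \<circ> Conf = j \<circ> Conf" using upper_nb_SomeD(3)[OF j] by auto
  then show "lift_conf F j (upd z Vpar (nodes M Vpar (Suc (j Vpar)))) =
      lift_conf F j' (upd z Vpar (nodes M Vpar (j' Vpar)))"
    by (simp add: lift_conf_def fst_upd_Vpar)
qed

lemma cont_dir_lift_X_cont: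
  assumes "F \<in> X_cont M p" "d \<noteq> Mu"
  shows "cont_dir M d (lift_conf F)"
  using assms cont_dir_lift_Vpar by (cases d) (auto simp: X_cont_def)

text \<open>Away from direction \<open>Mu\<close>, overwriting the \<open>d\<close>-coordinate
  leaves the factor \<open>\<mu>\<close> of \<open>Bdisc\<close> alone, so the three continuous
  summands combine, also across a periodic seam.\<close>

lemma cont_dir_ham:
  assumes "vpar_sq S \<in> V_cont (grid S) p" "Bdisc S \<in> X_cont (grid S) p"
    "Pz S (pot U t) \<in> X_cont (grid S) p" "d \<noteq> Mu"
  shows "cont_dir (grid S) d (ham S U s t)"
proof -
  have c: "cont_dir (grid S) d (vpar_sq S)" "cont_dir (grid S) d (lift_conf (Bdisc S))"
    "cont_dir (grid S) d (lift_conf (Pz S (pot U t)))"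
    using assms cont_dir_lift_X_cont by (auto simp: V_cont_def)
  show ?thesis
    unfolding cont_dir_def
  proof (intro ballI allI impI)
    fix j j' z assume h: "j \<in> phase_idxs (grid S)" "upper_nb (grid S) d j = Some j'" "z \<in> phase_cell (grid S) j"
    show "ham S U s t j (upd z d (nodes (grid S) d (Suc (j d)))) = ham S U s t j' (upd z d (nodes (grid S) d (j' d)))"
      using c[unfolded cont_dir_def lift_conf_def, rule_format, OF h] assms(4)
      by (simp add: ham_def coord_upd)
  qed
qed

text \<open>This is what makes the Hamiltonian an admissible test function of the kinetic
  equation.\<close>

lemma serendipity_ham:
  assumes "vpar_sq S \<in> V_space (grid S) p" "Bdisc S \<in> X_space (grid S) p"
    "Pz S (pot U t) \<in> X_space (grid S) p" "j \<in> phase_idxs (grid S)"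
  shows "ham S U s t j \<in> serendipity p"
proof -
  note V = fun_subspaceD[OF serendipity_subspace(1)[of p]]
  have "(\<lambda>z. 1 / 2 * mass S s * vpar_sq S j z + coord z Mu * Bdisc S (j \<circ> Conf) (fst z)
     + charge S s * Pz S (pot U t) (j \<circ> Conf) (fst z)) \<in> serendipity p"
    using assms by (intro V(2) V(3) Mu_mult_serendipity X_space_phase) (auto simp: V_space_def)
  then show ?thesis by (simp add: ham_def[abs_def])
qed

subsection \<open>Conservation of the Hamiltonian along the characteristics\<close>

lemma dconf_nth: "dconf i (\<lambda>R. R $ k) R = (if k = i then 1 else 0)"
proof -
  have "((\<lambda>R :: conf_pt. R $ k) has_derivative (\<lambda>R. R $ k)) (at R)"
    by (rule bounded_linear_imp_has_derivative[OF bounded_linear_vec_nth])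
  from frechet_derivative_at[OF this] have "frechet_derivative (\<lambda>R. R $ k) (at R) = (\<lambda>R. R $ k)" by simp
  then show ?thesis by (simp add: dconf_def axis_def)
qed

lemma dconf_const: "dconf i (\<lambda>_. c) R = 0"
  by (simp add: dconf_def)

lemma poisson_bracket_position:
  "poisson_bracket G q m A (\<lambda>z'. fst z' $ i) H z =
    1 / (m * Bmag G (fst z)) * dpar H z * (Bstar G q m A z \<bullet> grad_coord G i (fst z))
    - 1 / (q * Bmag G (fst z)) *
      (cross3 (bhat G (fst z)) (grad_coord G i (fst z)) \<bullet> grad G (\<lambda>R. H (R, snd z)) (fst z))"
proof -
  have "grad G (\<lambda>R. R $ i) (fst z) = grad_coord G i (fst z)"
    by (simp add: grad_def dconf_nth if_distrib[of "\<lambda>c. c *\<^sub>R _"] sum.delta' cong: if_cong)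
  moreover have "dpar (\<lambda>z'. fst z' $ i) z = 0" by (simp add: dpar_def)
  ultimately show ?thesis
    by (simp add: poisson_bracket_def Let_def)
qed

lemma poisson_bracket_vpar:
  "poisson_bracket G q m A (\<lambda>z'. coord z' Vpar) H z =
    - (1 / (m * Bmag G (fst z)) * (Bstar G q m A z \<bullet> grad G (\<lambda>R. H (R, snd z)) (fst z)))"
proof -
  have "grad G (\<lambda>R. fst (snd z)) (fst z) = 0"
    by (simp add: grad_def dconf_const)
  moreover have "dpar (\<lambda>z'. fst (snd z')) z = 1" by (simp add: dpar_def)
  ultimately show ?thesis
    by (simp add: poisson_bracket_def Let_def coord_def cross_zero_right)
qed

text \<open>This is \<open>{H, H} = 0\<close>, contracted with the partial derivatives of
  \<open>H\<close>. These rebuild the gradient of \<open>H\<close> from the vectors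
  \<open>grad_coord\<close>; the two terms with \<open>Bstar\<close> then cancel, and the drift term
  vanishes because \<open>b \<times> \<nabla>H\<close> is orthogonal to \<open>\<nabla>H\<close>.
  The identity is pointwise and algebraic, hence exact at the discrete level.\<close>

lemma ham_conserved:
  "(\<Sum>i\<in>UNIV. Rdot S U s t j z $ i * dconf i (\<lambda>R. ham S U s t j (R, snd z)) (fst z))
    + vdotH S U s t j z * dpar (ham S U s t j) z = 0"
proof -
  let ?H = "ham S U s t j" and ?G = "geom S" and ?R = "fst z"
  let ?d = "\<lambda>i. dconf i (\<lambda>R. ?H (R, snd z)) ?R" and ?g = "\<lambda>i. grad_coord ?G i ?R"
  define B where "B = Bstar ?G (charge S s) (mass S s) (apar U t (j \<circ> Conf)) z"
  define a where "a = 1 / (mass S s * Bmag ?G ?R)"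
  define c where "c = 1 / (charge S s * Bmag ?G ?R)"
  define gH where "gH = grad ?G (\<lambda>R. ?H (R, snd z)) ?R"
  have gH: "gH = (\<Sum>i\<in>UNIV. ?d i *\<^sub>R ?g i)" by (simp add: gH_def grad_def)
  have "(\<Sum>i\<in>UNIV. Rdot S U s t j z $ i * ?d i) =
      (\<Sum>i\<in>UNIV. (a * dpar ?H z * (B \<bullet> ?g i) - c * (cross3 (bhat ?G ?R) (?g i) \<bullet> gH)) * ?d i)"
    unfolding Rdot_def vec_lambda_beta poisson_bracket_position B_def a_def c_def gH_def ..
  also have "\<dots> = a * dpar ?H z * (B \<bullet> gH) - c * (cross3 (bhat ?G ?R) gH \<bullet> gH)"
  proof -
    have "cross3 b (\<Sum>i\<in>UNIV. ?d i *\<^sub>R ?g i) = (\<Sum>i\<in>UNIV. ?d i *\<^sub>R cross3 b (?g i))" for b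
      by (subst linear_sum[of "cross3 b"])
         (auto simp: cross_mult_right cross_add_right intro!: linearI)
    then have "cross3 b gH \<bullet> v = (\<Sum>i\<in>UNIV. ?d i * (cross3 b (?g i) \<bullet> v))" for b v
      by (simp add: gH inner_sum_left)
    moreover have "B \<bullet> gH = (\<Sum>i\<in>UNIV. ?d i * (B \<bullet> ?g i))"
      by (simp add: gH inner_sum_right)
    ultimately show ?thesis
      by (simp add: sum_distrib_left sum_subtractf[symmetric] algebra_simps)
  qed
  also have "cross3 (bhat ?G ?R) gH \<bullet> gH = 0" by (simp add: dot_cross_self inner_commute)
  finally have "(\<Sum>i\<in>UNIV. Rdot S U s t j z $ i * ?d i) = a * dpar ?H z * (B \<bullet> gH)" by simp
  moreover have "vdotH S U s t j z = - (a * (B \<bullet> gH))"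
    unfolding vdotH_def poisson_bracket_vpar B_def a_def gH_def ..
  ultimately show ?thesis by (simp add: algebra_simps)
qed

subsection \<open>Energy balance\<close>

lemma continuous_on_lift:
  assumes "continuous_on (conf_cell M (j \<circ> Conf)) f"
  shows "continuous_on (phase_cell M j) (\<lambda>z. f (fst z))"
  by (rule continuous_on_compose2[OF assms continuous_on_fst[OF continuous_on_id]])
     (auto simp: phase_cell_def)

lemma cell_int_add:
  assumes "continuous_on (phase_cell M j) F" "continuous_on (phase_cell M j) G"
  shows "cell_int M m j (\<lambda>z. F z + G z) = cell_int M m j F + cell_int M m j G"
    "cell_int M m j (\<lambda>z. F z - G z) = cell_int M m j F - cell_int M m j G"
  using assms by (simp_all add: cell_int_def set_integral_add set_integral_diff
      set_integrable_compact compact_cells algebra_simps)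

lemma cell_int_cmult: "cell_int M m j (\<lambda>z. c * F z) = c * cell_int M m j F"
  by (simp add: cell_int_def)

lemma conf_int_weighted_sum:
  fixes c :: "'s::finite \<Rightarrow> real"
  assumes h: "\<And>k. k \<in> conf_idxs M \<Longrightarrow> continuous_on (conf_cell M k) (h k)"
    and v: "\<And>s k. k \<in> conf_idxs M \<Longrightarrow> continuous_on (conf_cell M k) (v s k)"
  shows "conf_int M (\<lambda>k R. h k R * (\<Sum>s\<in>UNIV. c s * v s k R)) =
    (\<Sum>s\<in>UNIV. c s * conf_int M (\<lambda>k R. h k R * v s k R))"
proof -
  have "(LINT R:conf_cell M k|lborel. h k R * (\<Sum>s\<in>UNIV. c s * v s k R)) =
      (\<Sum>s\<in>UNIV. c s * (LINT R:conf_cell M k|lborel. h k R * v s k R))" if k: "k \<in> conf_idxs M" for k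
  proof -
    have int: "set_integrable lborel (conf_cell M k) (\<lambda>R. c s * (h k R * v s k R))" for s
      by (intro set_integrable_compact compact_cells continuous_intros h[OF k] v[OF k])
    have "(LINT R:conf_cell M k|lborel. h k R * (\<Sum>s\<in>UNIV. c s * v s k R)) =
        (LINT R:conf_cell M k|lborel. \<Sum>s\<in>UNIV. c s * (h k R * v s k R))"
      by (simp add: sum_distrib_left mult.left_commute)
    also have "\<dots> = (\<Sum>s\<in>UNIV. LINT R:conf_cell M k|lborel. c s * (h k R * v s k R))"
      using int unfolding set_lebesgue_integral_def set_integrable_def scaleR_sum_right
      by (rule Bochner_Integration.integral_sum)
    finally show ?thesis by simp
  qed
  then have "conf_int M (\<lambda>k R. h k R * (\<Sum>s\<in>UNIV. c s * v s k R)) =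
      (\<Sum>k\<in>conf_idxs M. \<Sum>s\<in>UNIV. c s * (LINT R:conf_cell M k|lborel. h k R * v s k R))"
    by (simp add: conf_int_def)
  also have "\<dots> = (\<Sum>s\<in>UNIV. c s * conf_int M (\<lambda>k R. h k R * v s k R))"
    unfolding conf_int_def sum_distrib_left by (rule sum.swap)
  finally show ?thesis .
qed

lemma grad_perp_add:
  assumes "real_polynomial_function f" "real_polynomial_function g"
  shows "grad_perp G (\<lambda>x. f x + g x) R = grad_perp G f R + grad_perp G g R"
  by (simp add: grad_perp_def grad_def dconf_add[OF assms] scaleR_add_left sum.distrib
      inner_add_right)

lemma grad_perp_cmult:
  assumes "real_polynomial_function f"
  shows "grad_perp G (\<lambda>x. c * f x) R = c *\<^sub>R grad_perp G f R"
proof -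
  have "grad G (\<lambda>x. c * f x) R = c *\<^sub>R grad G f R"
    by (simp add: grad_def dconf_cmult[OF assms] scaleR_sum_right)
  then show ?thesis by (simp add: grad_perp_def scaleR_diff_right)
qed

section \<open>Regularity of a discrete solution in phase space and time\<close>

locale dg_solution =
  fixes S :: "'s::finite gk_setup" and U :: "'s gk_state" and T :: "real set"
  assumes mesh: "valid_mesh (grid S)"
    and geometry: "valid_geometry (grid S) (geom S)"
    and species: "valid_species S"
    and mu0_pos: "0 < mu0 S"
    and vpar_sq: "vpar_sq S \<in> V_cont (grid S) (deg S)"
    and Bdisc: "Bdisc S \<in> X_cont (grid S) (deg S)"
    and adjoint: "z_adjoint (grid S) (deg S) (Pz S) (Pz_adj S)"
    and T_open: "open T"
    and dist: "\<And>s t. t \<in> T \<Longrightarrow> dist_fn U s t \<in> V_space (grid S) (deg S)"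
    and pot: "\<And>t. t \<in> T \<Longrightarrow> pot U t \<in> X_cont_xy (grid S) (deg S)"
    and Pz_pot: "\<And>t. t \<in> T \<Longrightarrow> Pz S (pot U t) \<in> X_cont (grid S) (deg S)"
    and apar: "\<And>t. t \<in> T \<Longrightarrow> apar U t \<in> X_cont_xy (grid S) (deg S)"
    and C1: "C1_in_time S U T"
    and charac: "\<And>s t d. t \<in> T \<Longrightarrow> cont_dir (grid S) d (charac S U s t d)"
    and upw: "\<And>s t d. t \<in> T \<Longrightarrow> cont_dir (grid S) d (upw U s t d)"
    and dg: "\<And>s t. t \<in> T \<Longrightarrow> dg_equation S U s t"
    and poisson: "\<And>t. t \<in> T \<Longrightarrow> poisson_equation S U t"
    and ampere: "\<And>t. t \<in> T \<Longrightarrow> ampere_equation S U t"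
begin

abbreviation "M \<equiv> grid S"
abbreviation "G \<equiv> geom S"
abbreviation "p \<equiv> deg S"

lemma conf_cell_domain: "k \<in> conf_idxs M \<Longrightarrow> conf_cell M k \<subseteq> conf_domain M"
  by (auto simp: conf_domain_def)

lemma geometry_domain:
  assumes "R \<in> conf_domain M"
  shows "Bmag G R \<noteq> 0" "bhat G differentiable (at R)"
  using geometry assms unfolding valid_geometry_def by force+

lemma continuous_geometry:
  assumes "k \<in> conf_idxs M"
  shows "continuous_on (conf_cell M k) (Bmag G)" "continuous_on (conf_cell M k) (bhat G)"
    "continuous_on (conf_cell M k) (grad_coord G i)" "continuous_on (conf_cell M k) (curl_b G)"
    "continuous_on (conf_cell M k) (eps_perp S)"
proof -
  note sub = continuous_on_subset[OF _ conf_cell_domain[OF assms]]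
  show B: "continuous_on (conf_cell M k) (Bmag G)" and g: "continuous_on (conf_cell M k) (grad_coord G i)" for i
    using geometry unfolding valid_geometry_def by (auto intro: sub)
  have "continuous_on (conf_domain M) (bhat G)"
    by (intro continuous_at_imp_continuous_on ballI differentiable_imp_continuous_within geometry_domain)
  then show "continuous_on (conf_cell M k) (bhat G)" by (rule sub)
  have "continuous_on (conf_cell M k) (dconf i (bhat G))" for i
    using geometry unfolding valid_geometry_def by (auto intro: sub)
  then show "continuous_on (conf_cell M k) (curl_b G)"
    unfolding curl_b_def[abs_def] by (intro continuous_intros continuous_on_cross g)
  have "continuous_on (conf_cell M k) (dens0 S s)" for s
    using species unfolding valid_species_def by (auto intro: sub)
  then show "continuous_on (conf_cell M k) (eps_perp S)"
    unfolding eps_perp_def[abs_def]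
    using geometry_domain(1) conf_cell_domain[OF assms] by (intro continuous_intros B) auto
qed

lemma continuous_grad:
  assumes "k \<in> conf_idxs M" "real_polynomial_function f"
  shows "continuous_on (conf_cell M k) (grad G f)" "continuous_on (conf_cell M k) (grad_perp G f)"
proof -
  show g: "continuous_on (conf_cell M k) (grad G f)"
    unfolding grad_def[abs_def]
    by (intro continuous_intros continuous_on_dconf assms continuous_geometry)
  show "continuous_on (conf_cell M k) (grad_perp G f)"
    unfolding grad_perp_def[abs_def]
    by (intro continuous_intros g continuous_geometry assms)
qed

lemma pot_poly: "t \<in> T \<Longrightarrow> k \<in> conf_idxs M \<Longrightarrow> pot U t k \<in> conf_serendipity p"
  and apar_poly: "t \<in> T \<Longrightarrow> k \<in> conf_idxs M \<Longrightarrow> apar U t k \<in> conf_serendipity p"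
  and Pz_poly: "t \<in> T \<Longrightarrow> k \<in> conf_idxs M \<Longrightarrow> Pz S (pot U t) k \<in> conf_serendipity p"
  using pot apar Pz_pot by (auto intro!: X_space_conf[OF mesh] simp: X_cont_xy_def X_cont_def)

lemma dist_poly: "t \<in> T \<Longrightarrow> j \<in> phase_idxs M \<Longrightarrow> dist_fn U s t j \<in> serendipity p"
  using dist by (simp add: V_space_def)

lemma ham_poly: "t \<in> T \<Longrightarrow> j \<in> phase_idxs M \<Longrightarrow> ham S U s t j \<in> serendipity p"
  using vpar_sq Bdisc Pz_pot
  by (intro serendipity_ham) (auto simp: V_cont_def X_cont_def)

lemmas space_polynomials = serendipity_polynomial[OF dist_poly] serendipity_polynomial[OF ham_poly]
  conf_serendipity_polynomial[OF pot_poly] conf_serendipity_polynomial[OF apar_poly]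
  conf_serendipity_polynomial[OF Pz_poly]

lemma differentiable_in_time:
  assumes t: "t \<in> T"
  shows "j \<in> phase_idxs M \<Longrightarrow> z \<in> phase_cell M j \<Longrightarrow> (\<lambda>\<tau>. dist_fn U s \<tau> j z) differentiable (at t)"
    and "k \<in> conf_idxs M \<Longrightarrow> R \<in> conf_cell M k \<Longrightarrow> (\<lambda>\<tau>. pot U \<tau> k R) differentiable (at t)"
    and "k \<in> conf_idxs M \<Longrightarrow> R \<in> conf_cell M k \<Longrightarrow> (\<lambda>\<tau>. apar U \<tau> k R) differentiable (at t)"
proof -
  have d: "f differentiable (at t)" if "f C1_differentiable_on T" for f :: "real \<Rightarrow> real"
    using that t unfolding C1_differentiable_on_def by (blast intro: differentiableI_vector)
  show "j \<in> phase_idxs M \<Longrightarrow> z \<in> phase_cell M j \<Longrightarrow> (\<lambda>\<tau>. dist_fn U s \<tau> j z) differentiable (at t)"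
    "k \<in> conf_idxs M \<Longrightarrow> R \<in> conf_cell M k \<Longrightarrow> (\<lambda>\<tau>. pot U \<tau> k R) differentiable (at t)"
    "k \<in> conf_idxs M \<Longrightarrow> R \<in> conf_cell M k \<Longrightarrow> (\<lambda>\<tau>. apar U \<tau> k R) differentiable (at t)"
    using C1 unfolding C1_in_time_def by (blast intro: d)+
qed

text \<open>The time derivative is a combination of the same fixed basis polynomials, so the
  inductive field is polynomial, hence continuous, on each cell.\<close>

lemma dt_apar_poly:
  assumes "t \<in> T" "k \<in> conf_idxs M"
  shows "dt (apar U) t k \<in> conf_serendipity p"
proof -
  obtain Z l where "interpolation (conf_serendipity p) (conf_cell M k) Z l"
    using interpolation_conf[OF mesh assms(2)] by blast
  from deriv_in_subspace[OF serendipity_subspace(2) this T_open assms(1), of "\<lambda>\<tau>. apar U \<tau> k"]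
  show ?thesis
    using apar_poly differentiable_in_time(3) assms by (simp add: dt_def[abs_def])
qed

lemma continuous_Jf:
  assumes "t \<in> T" "j \<in> phase_idxs M"
  shows "continuous_on (phase_cell M j) (Jf S U s t j)"
  unfolding Jf_def[abs_def]
  by (intro continuous_intros continuous_on_lift continuous_geometry phase_idxs_Conf assms
      real_polynomial_function_continuous_on space_polynomials)

lemma continuous_dpar_ham:
  assumes "t \<in> T" "j \<in> phase_idxs M"
  shows "continuous_on (phase_cell M j) (dpar (ham S U s t j))"
proof -
  have "dpar (ham S U s t j) = (\<lambda>z. frechet_derivative (ham S U s t j) (at z) (0, 1, 0))"
    using dpar_phase[OF space_polynomials(2)[OF assms]] by blast
  then show ?thesis
    using real_polynomial_function_frechet_derivative[OF space_polynomials(2)[OF assms]]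
    by (metis real_polynomial_function_continuous_on)
qed

text \<open>Supplies the integrability with which \<open>species_energy\<close> splits the inductive
  part off the parallel acceleration.\<close>

lemma continuous_vdotH:
  assumes "t \<in> T" "j \<in> phase_idxs M"
  shows "continuous_on (phase_cell M j) (vdotH S U s t j)"
proof -
  note k = phase_idxs_Conf[OF assms(2)]
  note lift = continuous_on_lift[OF continuous_geometry(1)[OF k]] continuous_on_lift[OF continuous_geometry(2)[OF k]]
    continuous_on_lift[OF continuous_geometry(3)[OF k]] continuous_on_lift[OF continuous_geometry(4)[OF k]]
    continuous_on_lift[OF continuous_grad(1)[OF k space_polynomials(4)[OF assms(1) k]]]
  have "Bmag G (fst z) \<noteq> 0" "mass S s \<noteq> 0" if "z \<in> phase_cell M j" for z
    using geometry_domain(1)[of "fst z"] conf_cell_domain[OF k] that species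
    by (auto simp: phase_cell_def valid_species_def less_imp_neq[THEN not_sym])
  moreover have "continuous_on (phase_cell M j) (\<lambda>z. coord z Vpar)"
    by (rule linear_continuous_on[OF bounded_linear_coord])
  moreover have "charge S s \<noteq> 0" using species by (simp add: valid_species_def)
  moreover have "continuous_on (phase_cell M j) (\<lambda>z. dconf i (\<lambda>R. ham S U s t j (R, snd z)) (fst z))" for i
    unfolding dconf_phase[OF space_polynomials(2)[OF assms]]
    by (intro real_polynomial_function_continuous_on real_polynomial_function_frechet_derivative
        space_polynomials assms)
  ultimately show ?thesis
    unfolding vdotH_def[abs_def] poisson_bracket_vpar Bstar_def Let_def grad_def[of _ "\<lambda>R. ham S U s t j (R, snd _)"]
    by (intro continuous_intros continuous_on_cross lift) auto
qed

text \<open>The weight \<open>w\<close> is frozen in time and so is the Jacobian; only the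
  distribution function is differentiated, through its node values.\<close>

lemma kinetic_deriv:
  assumes t: "t \<in> T"
    and w: "\<And>j. j \<in> phase_idxs M \<Longrightarrow> continuous_on (phase_cell M j) (w j)"
  shows "((\<lambda>\<tau>. \<Sum>j\<in>phase_idxs M. cell_int M m j (\<lambda>z. Jf S U s \<tau> j z * w j z)) has_real_derivative
    (\<Sum>j\<in>phase_idxs M. cell_int M m j (\<lambda>z. w j z * dt (Jf S U s) t j z))) (at t)"
proof (rule DERIV_sum)
  fix j assume j: "j \<in> phase_idxs M"
  note k = phase_idxs_Conf[OF j]
  obtain Z l where I: "interpolation (serendipity p) (phase_cell M j) Z l"
    using interpolation_phase[OF mesh j] by blast
  note time = I T_open t dist_poly[OF _ j] differentiable_in_time(1)[OF t j]
  have "linear_functional_on (serendipity p) (\<lambda>f. LINT z:phase_cell M j|lborel. Bmag G (fst z) * f z * w j z)"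
  proof (rule linear_functional_integral[OF compact_cells(3) serendipity_subspace(1)])
    fix f assume "f \<in> serendipity p"
    then show "continuous_on (phase_cell M j) (\<lambda>z. Bmag G (fst z) * f z * w j z)"
      by (intro continuous_intros continuous_on_lift continuous_geometry k w[OF j]
          real_polynomial_function_continuous_on serendipity_polynomial)
  qed (simp_all add: algebra_simps)
  from linear_functional_deriv[OF serendipity_subspace(1) time this]
  have "((\<lambda>\<tau>. LINT z:phase_cell M j|lborel. Jf S U s \<tau> j z * w j z) has_real_derivative
      (LINT z:phase_cell M j|lborel. Bmag G (fst z) * deriv (\<lambda>\<tau>. dist_fn U s \<tau> j z) t * w j z)) (at t)"
    by (simp add: Jf_def)
  moreover have "dt (Jf S U s) t j z = Bmag G (fst z) * deriv (\<lambda>\<tau>. dist_fn U s \<tau> j z) t" for z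
  proof -
    have "((\<lambda>\<tau>. dist_fn U s \<tau> j z) has_real_derivative deriv (\<lambda>\<tau>. dist_fn U s \<tau> j z) t) (at t)"
    proof -
      note D = interpolation_deriv[OF time, of s z]
      \<comment> \<open>The derivative in \<open>D\<close> is a sum over nodes, which
        \<open>DERIV_imp_deriv\<close> identifies with \<open>deriv\<close>.\<close>
      show ?thesis using D DERIV_imp_deriv[OF D] by (rule ssubst[rotated])
    qed
    from DERIV_cmult[OF this, of "Bmag G (fst z)"] show ?thesis
      unfolding dt_def Jf_def by (rule DERIV_imp_deriv)
  qed
  ultimately show "((\<lambda>\<tau>. cell_int M m j (\<lambda>z. Jf S U s \<tau> j z * w j z)) has_real_derivative
      cell_int M m j (\<lambda>z. w j z * dt (Jf S U s) t j z)) (at t)"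
    unfolding cell_int_def by (intro DERIV_cmult) (simp add: mult.commute)
qed

lemma gradient_form:
  assumes k: "k \<in> conf_idxs M" and w: "continuous_on (conf_cell M k) w"
    and g: "g \<in> conf_serendipity p"
  shows "linear_functional_on (conf_serendipity p)
    (\<lambda>f. LINT R:conf_cell M k|lborel. w R * (grad_perp G f R \<bullet> grad_perp G g R))"
  by (rule linear_functional_integral[OF compact_cells(1) serendipity_subspace(2)])
     (auto intro!: continuous_intros continuous_grad k w conf_serendipity_polynomial g
        simp: grad_perp_add grad_perp_cmult conf_serendipity_polynomial algebra_simps inner_add_left)

text \<open>The gradient form with one argument frozen at \<open>t\<close>, and with both arguments
  moving. The second derivative is twice the first, which makes the field terms of the energy
  stationary.\<close>

lemma gradient_form_deriv:
  assumes t: "t \<in> T" and w: "\<And>k. k \<in> conf_idxs M \<Longrightarrow> continuous_on (conf_cell M k) w"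
    and F: "\<And>\<tau> k. \<tau> \<in> T \<Longrightarrow> k \<in> conf_idxs M \<Longrightarrow> F \<tau> k \<in> conf_serendipity p"
    and D: "\<And>k R. k \<in> conf_idxs M \<Longrightarrow> R \<in> conf_cell M k \<Longrightarrow> (\<lambda>\<tau>. F \<tau> k R) differentiable (at t)"
  shows "((\<lambda>\<tau>. conf_int M (\<lambda>k R. w R * (grad_perp G (F \<tau> k) R \<bullet> grad_perp G (F t k) R)))
      has_real_derivative conf_int M (\<lambda>k R. w R * (grad_perp G (dt F t k) R \<bullet> grad_perp G (F t k) R))) (at t)"
    and "((\<lambda>\<tau>. conf_int M (\<lambda>k R. w R * (grad_perp G (F \<tau> k) R \<bullet> grad_perp G (F \<tau> k) R)))
      has_real_derivative 2 * conf_int M (\<lambda>k R. w R * (grad_perp G (dt F t k) R \<bullet> grad_perp G (F t k) R))) (at t)"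
proof -
  have dt: "dt F t k = (\<lambda>R. deriv (\<lambda>\<tau>. F \<tau> k R) t)" for k by (simp add: dt_def[abs_def])
  show "((\<lambda>\<tau>. conf_int M (\<lambda>k R. w R * (grad_perp G (F \<tau> k) R \<bullet> grad_perp G (F t k) R)))
      has_real_derivative conf_int M (\<lambda>k R. w R * (grad_perp G (dt F t k) R \<bullet> grad_perp G (F t k) R))) (at t)"
    unfolding conf_int_def
  proof (rule DERIV_sum)
    fix k assume k: "k \<in> conf_idxs M"
    obtain Z l where I: "interpolation (conf_serendipity p) (conf_cell M k) Z l"
      using interpolation_conf[OF mesh k] by blast
    show "((\<lambda>\<tau>. LINT R:conf_cell M k|lborel. w R * (grad_perp G (F \<tau> k) R \<bullet> grad_perp G (F t k) R))
      has_real_derivative (LINT R:conf_cell M k|lborel. w R * (grad_perp G (dt F t k) R \<bullet> grad_perp G (F t k) R))) (at t)"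
      unfolding dt by (rule linear_functional_deriv[OF serendipity_subspace(2) I T_open t F[OF _ k] D[OF k]
            gradient_form[OF k w[OF k] F[OF t k]]])
  qed
  show "((\<lambda>\<tau>. conf_int M (\<lambda>k R. w R * (grad_perp G (F \<tau> k) R \<bullet> grad_perp G (F \<tau> k) R)))
      has_real_derivative 2 * conf_int M (\<lambda>k R. w R * (grad_perp G (dt F t k) R \<bullet> grad_perp G (F t k) R))) (at t)"
    unfolding conf_int_def sum_distrib_left
  proof (rule DERIV_sum)
    fix k assume k: "k \<in> conf_idxs M"
    obtain Z l where I: "interpolation (conf_serendipity p) (conf_cell M k) Z l"
      using interpolation_conf[OF mesh k] by blast
    show "((\<lambda>\<tau>. LINT R:conf_cell M k|lborel. w R * (grad_perp G (F \<tau> k) R \<bullet> grad_perp G (F \<tau> k) R))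
      has_real_derivative 2 * (LINT R:conf_cell M k|lborel. w R * (grad_perp G (dt F t k) R \<bullet> grad_perp G (F t k) R))) (at t)"
      unfolding dt by (rule symmetric_form_deriv[OF serendipity_subspace(2) I T_open t F[OF _ k] D[OF k]
            gradient_form[OF k w[OF k]]])
        (simp_all add: inner_commute)
  qed
qed

section \<open>Field energies and the work of the inductive field\<close>

abbreviation pot_form :: "real \<Rightarrow> real \<Rightarrow> real" where
  "pot_form \<tau> \<tau>' \<equiv>
    conf_int M (\<lambda>k R. eps_perp S R * (grad_perp G (pot U \<tau> k) R \<bullet> grad_perp G (pot U \<tau>' k) R))"

text \<open>Summing the velocity moments over species gives \<open>sigma_g\<close> at time
  \<open>\<tau>\<close>. The adjoint moves the smoothing from the potential at
  \<open>\<tau>'\<close> onto it, and the Poisson equation at time \<open>\<tau>\<close> is tested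
  with the potential at \<open>\<tau>'\<close>, which lies in the same test space at every
  time.\<close>

lemma interaction_energy:
  assumes t: "\<tau> \<in> T" "\<tau>' \<in> T"
  shows "(\<Sum>s\<in>UNIV. \<Sum>j\<in>phase_idxs M. cell_int M (mass S s) j
      (\<lambda>z. Jf S U s \<tau> j z * (charge S s * Pz S (pot U \<tau>') (j \<circ> Conf) (fst z)))) = pot_form \<tau> \<tau>'"
proof -
  let ?\<phi> = "Pz S (pot U \<tau>')"
  have \<phi>: "continuous_on (conf_cell M k) (?\<phi> k)" if "k \<in> conf_idxs M" for k
    by (intro real_polynomial_function_continuous_on space_polynomials t that)
  have v: "continuous_on (conf_cell M k) (vel_int M (mass S s) (Jf S U s \<tau>) k)" for s k
    by (intro continuous_on_vel_int continuous_Jf t)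
  have \<sigma>: "continuous_on (conf_cell M k) (sigma_g S U \<tau> k)" for k
    unfolding sigma_g_def[abs_def] by (intro continuous_intros v)
  have X: "pot U \<tau>' \<in> X_space M p" "pot U \<tau>' \<in> X_cont_xy M p"
    using pot[OF t(2)] by (auto simp: X_cont_xy_def)
  have "(\<Sum>s\<in>UNIV. \<Sum>j\<in>phase_idxs M. cell_int M (mass S s) j
      (\<lambda>z. Jf S U s \<tau> j z * (charge S s * ?\<phi> (j \<circ> Conf) (fst z)))) =
    (\<Sum>s\<in>UNIV. charge S s * conf_int M (\<lambda>k R. ?\<phi> k R * vel_int M (mass S s) (Jf S U s \<tau>) k R))"
    by (subst conf_int_vel_int)
       (use continuous_Jf t \<phi> in \<open>auto simp: sum_distrib_left mult_ac simp flip: cell_int_cmult\<close>)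
  also have "\<dots> = conf_int M (\<lambda>k R. ?\<phi> k R * sigma_g S U \<tau> k R)"
    unfolding sigma_g_def by (rule conf_int_weighted_sum[symmetric]) (use \<phi> v in auto)
  also have "\<dots> = conf_int M (\<lambda>k R. sigma_g S U \<tau> k R * ?\<phi> k R)" by (simp add: mult.commute)
  also have "\<dots> = conf_int M (\<lambda>k R. Pz_adj S (sigma_g S U \<tau>) k R * pot U \<tau>' k R)"
    using adjoint \<sigma> X unfolding z_adjoint_def by blast
  also have "\<dots> = conf_int M (\<lambda>k R. pot U \<tau>' k R * Pz_adj S (sigma_g S U \<tau>) k R)" by (simp add: mult.commute)
  also have "\<dots> = pot_form \<tau> \<tau>'"
    using poisson[OF t(1)] X unfolding poisson_equation_def by simp
  finally show ?thesis .
qed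

text \<open>The velocity-space integrand of \<open>J_par\<close>, up to the factor charge over mass.
  Multiplied by that factor and by minus the time derivative of \<open>apar\<close>, it gives the
  power of the inductive field.\<close>

definition power_density :: "'s \<Rightarrow> real \<Rightarrow> phase_fam" where
  "power_density s t j z = Bmag G (fst z) * dpar (ham S U s t j) z * dist_fn U s t j z"

lemma continuous_power_density:
  assumes "t \<in> T" "j \<in> phase_idxs M"
  shows "continuous_on (phase_cell M j) (power_density s t j)"
  unfolding power_density_def[abs_def]
  by (intro continuous_intros continuous_on_lift continuous_geometry phase_idxs_Conf assms
      real_polynomial_function_continuous_on space_polynomials continuous_dpar_ham)

lemma J_par_eq:
  "J_par S U t k R =
    (\<Sum>s\<in>UNIV. charge S s / mass S s * vel_int M (mass S s) (power_density s t) k R)"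
  by (simp add: J_par_def power_density_def[abs_def])

lemma current_work:
  assumes t: "t \<in> T" and \<phi>: "\<And>k. k \<in> conf_idxs M \<Longrightarrow> continuous_on (conf_cell M k) (\<phi> k)"
  shows "conf_int M (\<lambda>k R. \<phi> k R * J_par S U t k R) =
    (\<Sum>s\<in>UNIV. charge S s / mass S s *
      (\<Sum>j\<in>phase_idxs M. cell_int M (mass S s) j (\<lambda>z. \<phi> (j \<circ> Conf) (fst z) * power_density s t j z)))"
proof -
  have "conf_int M (\<lambda>k R. \<phi> k R * J_par S U t k R) =
      (\<Sum>s\<in>UNIV. charge S s / mass S s *
        conf_int M (\<lambda>k R. \<phi> k R * vel_int M (mass S s) (power_density s t) k R))"
    unfolding J_par_eq by (rule conf_int_weighted_sum) (intro \<phi> continuous_on_vel_int continuous_power_density t; assumption)+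
  then show ?thesis
    by (simp add: conf_int_vel_int continuous_power_density t \<phi>)
qed

lemma continuous_dt_apar:
  "t \<in> T \<Longrightarrow> k \<in> conf_idxs M \<Longrightarrow> continuous_on (conf_cell M k) (dt (apar U) t k)"
  by (intro real_polynomial_function_continuous_on conf_serendipity_polynomial[OF dt_apar_poly])

text \<open>The kinetic equation is tested with the Hamiltonian and summed over cells. The surface
  terms cancel, and of the volume terms only the acceleration by the inductive field
  survives.\<close>

lemma species_energy:
  assumes t: "t \<in> T"
  shows "(\<Sum>j\<in>phase_idxs M. cell_int M (mass S s) j (\<lambda>z. ham S U s t j z * dt (Jf S U s) t j z)) =
    - (charge S s / mass S s * (\<Sum>j\<in>phase_idxs M. cell_int M (mass S s) j
        (\<lambda>z. dt (apar U) t (j \<circ> Conf) (fst z) * power_density s t j z)))"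
proof -
  let ?H = "ham S U s t" and ?m = "mass S s" and ?qm = "charge S s / mass S s"
  let ?w = "\<lambda>j z. dt (apar U) t (j \<circ> Conf) (fst z) * power_density s t j z"
  let ?surf = "\<lambda>j. (\<Sum>i\<in>UNIV. surface_term S U s t ?H j (Conf i)) + surface_term S U s t ?H j Vpar"
  have V: "?H \<in> V_space M p" using ham_poly[OF t] by (simp add: V_space_def)
  \<comment> \<open>\<open>ham_conserved\<close> cancels the transport in \<open>R\<close> against
    the \<open>vdotH\<close> part of \<open>vdot\<close>; the part with the time derivative of
    \<open>apar\<close> is left.\<close>
  have vol: "cell_int M ?m j (\<lambda>z. Jf S U s t j z
        * (\<Sum>i\<in>UNIV. Rdot S U s t j z $ i * dconf i (\<lambda>R. ?H j (R, snd z)) (fst z)))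
      + cell_int M ?m j (\<lambda>z. Jf S U s t j z * vdot S U s t j z * dpar (?H j) z)
      = - (?qm * cell_int M ?m j (?w j))" if j: "j \<in> phase_idxs M" for j
  proof -
    let ?a = "\<lambda>z. Jf S U s t j z * vdotH S U s t j z * dpar (?H j) z"
    have ca: "continuous_on (phase_cell M j) ?a"
      by (intro continuous_intros continuous_Jf continuous_vdotH continuous_dpar_ham t j)
    have cw: "continuous_on (phase_cell M j) (\<lambda>z. ?qm * ?w j z)"
      by (intro continuous_intros continuous_on_lift continuous_dt_apar continuous_power_density
          phase_idxs_Conf t j)
    have 1: "Jf S U s t j z * (\<Sum>i\<in>UNIV. Rdot S U s t j z $ i * dconf i (\<lambda>R. ?H j (R, snd z)) (fst z)) =
        (-1) * ?a z" for z
    proof -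
      have "(\<Sum>i\<in>UNIV. Rdot S U s t j z $ i * dconf i (\<lambda>R. ?H j (R, snd z)) (fst z)) =
          - (vdotH S U s t j z * dpar (?H j) z)"
        using ham_conserved[of S U s t j z] by linarith
      then show ?thesis by simp
    qed
    have 2: "Jf S U s t j z * vdot S U s t j z * dpar (?H j) z = ?a z - ?qm * ?w j z" for z
      by (simp add: vdot_def Jf_def power_density_def algebra_simps)
    show ?thesis
      unfolding 1 2 cell_int_cmult cell_int_add(2)[OF ca cw] by simp
  qed
  have "cell_int M ?m j (\<lambda>z. ?H j z * dt (Jf S U s) t j z) = - ?surf j + - (?qm * cell_int M ?m j (?w j))"
    if j: "j \<in> phase_idxs M" for j
    using dg[OF t, of s, unfolded dg_equation_def, rule_format, OF j V] vol[OF j] by linarith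
  then have "(\<Sum>j\<in>phase_idxs M. cell_int M ?m j (\<lambda>z. ?H j z * dt (Jf S U s) t j z)) =
      - (\<Sum>j\<in>phase_idxs M. ?surf j) - ?qm * (\<Sum>j\<in>phase_idxs M. cell_int M ?m j (?w j))"
    by (simp add: sum.distrib sum_negf sum_subtractf sum_distrib_left)
  moreover have "(\<Sum>j\<in>phase_idxs M. ?surf j) = 0"
  proof -
    \<comment> \<open>The kinetic equation has faces normal to the \<open>Conf\<close> directions
      and to \<open>Vpar\<close> only, which \<open>d \<noteq> Mu\<close> covers.\<close>
    have "(\<Sum>j\<in>phase_idxs M. surface_term S U s t ?H j d) = 0" if "d \<noteq> Mu" for d
      by (intro sum_surface_term mesh charac upw t cont_dir_ham[OF vpar_sq Bdisc Pz_pot] that)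
    then show ?thesis
      by (simp add: sum.distrib sum.swap[of _ "UNIV :: 3 set"])
  qed
  ultimately show ?thesis by simp
qed

text \<open>The Hamiltonian depends on time only through the smoothed potential. Replacing
  \<open>ham\<close> at \<open>\<tau>\<close> by \<open>ham\<close> at \<open>t\<close> therefore
  changes the energy by two interaction energies, and \<open>W_E\<close> removes half of the one
  with equal times.\<close>

lemma energy_splitting:
  assumes t: "t \<in> T" "\<tau> \<in> T"
  shows "W_H S U \<tau> - W_E S U \<tau> =
    (\<Sum>s\<in>UNIV. \<Sum>j\<in>phase_idxs M. cell_int M (mass S s) j (\<lambda>z. Jf S U s \<tau> j z * ham S U s t j z))
    + (1 / 2 * pot_form \<tau> \<tau> - pot_form \<tau> t)"
proof -
  let ?q = "\<lambda>s t j z. charge S s * Pz S (pot U t) (j \<circ> Conf) (fst z)"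
  have "cell_int M (mass S s) j (\<lambda>z. Jf S U s \<tau> j z * ham S U s \<tau> j z) =
      cell_int M (mass S s) j (\<lambda>z. Jf S U s \<tau> j z * ham S U s t j z)
      + (cell_int M (mass S s) j (\<lambda>z. Jf S U s \<tau> j z * ?q s \<tau> j z)
      - cell_int M (mass S s) j (\<lambda>z. Jf S U s \<tau> j z * ?q s t j z))" if j: "j \<in> phase_idxs M" for s j
  proof -
    have "Jf S U s \<tau> j z * ham S U s \<tau> j z =
        Jf S U s \<tau> j z * ham S U s t j z + (Jf S U s \<tau> j z * ?q s \<tau> j z - Jf S U s \<tau> j z * ?q s t j z)" for z
      by (simp add: ham_def algebra_simps)
    moreover have "continuous_on (phase_cell M j) (\<lambda>z. Jf S U s \<tau> j z * ham S U s t j z)"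
      by (intro continuous_intros continuous_Jf t j real_polynomial_function_continuous_on space_polynomials)
    moreover have "continuous_on (phase_cell M j) (\<lambda>z. Jf S U s \<tau> j z * ?q s t' j z)" if "t' \<in> T" for t'
      by (intro continuous_intros continuous_Jf t j real_polynomial_function_continuous_on space_polynomials
          continuous_on_lift phase_idxs_Conf that)
    ultimately show ?thesis
      using t by (simp add: cell_int_add continuous_on_diff)
  qed
  then have "W_H S U \<tau> = (\<Sum>s\<in>UNIV. \<Sum>j\<in>phase_idxs M. cell_int M (mass S s) j (\<lambda>z. Jf S U s \<tau> j z * ham S U s t j z))
      + (pot_form \<tau> \<tau> - pot_form \<tau> t)"
    unfolding W_H_def interaction_energy[OF t(2,2), symmetric] interaction_energy[OF t(2,1), symmetric]
    by (simp add: sum.distrib sum_subtractf)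
  moreover have "W_E S U \<tau> = 1 / 2 * pot_form \<tau> \<tau>"
    unfolding W_E_def conf_int_def by (simp add: power2_norm_eq_inner sum_divide_distrib)
  ultimately show ?thesis by simp
qed

text \<open>The derivative is the gradient form of \<open>dt (apar U) t\<close> and
  \<open>apar U t\<close>, divided by \<open>mu0\<close>; Ampere's law at time \<open>t\<close>
  turns this into the work on the current.\<close>

lemma W_B_deriv:
  assumes t: "t \<in> T"
  shows "(W_B S U has_real_derivative conf_int M (\<lambda>k R. dt (apar U) t k R * J_par S U t k R)) (at t)"
proof -
  let ?b = "\<lambda>F. conf_int M (\<lambda>k R. 1 * (grad_perp G (F k) R \<bullet> grad_perp G (apar U t k) R))"
  let ?J = "\<lambda>F. conf_int M (\<lambda>k R. F k R * J_par S U t k R)"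
  have form: "((\<lambda>\<tau>. ?b (apar U \<tau>)) has_real_derivative ?b (dt (apar U) t)) (at t)"
    "((\<lambda>\<tau>. conf_int M (\<lambda>k R. 1 * (grad_perp G (apar U \<tau> k) R \<bullet> grad_perp G (apar U \<tau> k) R)))
      has_real_derivative 2 * ?b (dt (apar U) t)) (at t)"
    by (rule gradient_form_deriv[OF t, where w = "\<lambda>_. 1" and F = "apar U"];
        simp add: apar_poly differentiable_in_time(3)[OF t])+
  \<comment> \<open>The current and one argument of the form stay at time \<open>t\<close> while the
    test function \<open>apar U \<tau>\<close> varies. Differentiating this identity in
    \<open>\<tau>\<close> gives Ampere's law for \<open>dt (apar U) t\<close>, without a proof that
    the latter is continuous in \<open>x\<close> and \<open>y\<close>.\<close>
  have amp: "?b (apar U \<tau>) = mu0 S * ?J (apar U \<tau>)" if "\<tau> \<in> T" for \<tau>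
    using ampere[OF t] apar[OF that] unfolding ampere_equation_def by (simp add: inner_commute)
  have J: "continuous_on (conf_cell M k) (J_par S U t k)" for k
    unfolding J_par_eq[abs_def]
    by (intro continuous_intros continuous_on_vel_int continuous_power_density t)
  have "((\<lambda>\<tau>. ?J (apar U \<tau>)) has_real_derivative ?J (dt (apar U) t)) (at t)"
    unfolding conf_int_def
  proof (rule DERIV_sum)
    fix k assume k: "k \<in> conf_idxs M"
    obtain Z l where I: "interpolation (conf_serendipity p) (conf_cell M k) Z l"
      using interpolation_conf[OF mesh k] by blast
    have "linear_functional_on (conf_serendipity p) (\<lambda>f. LINT R:conf_cell M k|lborel. f R * J_par S U t k R)"
    proof (rule linear_functional_integral[OF compact_cells(1) serendipity_subspace(2)])
      fix f assume "f \<in> conf_serendipity p"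
      then show "continuous_on (conf_cell M k) (\<lambda>R. f R * J_par S U t k R)"
        by (intro continuous_intros J real_polynomial_function_continuous_on conf_serendipity_polynomial)
    qed (simp_all add: algebra_simps)
    from linear_functional_deriv[OF serendipity_subspace(2) I T_open t apar_poly[OF _ k]
        differentiable_in_time(3)[OF t k] this]
    show "((\<lambda>\<tau>. LINT R:conf_cell M k|lborel. apar U \<tau> k R * J_par S U t k R) has_real_derivative
        (LINT R:conf_cell M k|lborel. dt (apar U) t k R * J_par S U t k R)) (at t)"
      by (simp add: dt_def)
  qed
  from DERIV_cmult[OF this, of "mu0 S"]
  have "((\<lambda>\<tau>. ?b (apar U \<tau>)) has_real_derivative mu0 S * ?J (dt (apar U) t)) (at t)"
    by (rule has_field_derivative_transform_within_open[OF _ T_open t]) (simp only: amp)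
  \<comment> \<open>The left-hand side now has two derivatives at \<open>t\<close>, and uniqueness
    equates them.\<close>
  then have b: "?b (dt (apar U) t) = mu0 S * ?J (dt (apar U) t)"
    by (rule DERIV_unique[OF form(1)])
  have "W_B S U = (\<lambda>\<tau>. 1 / (2 * mu0 S) *
      conf_int M (\<lambda>k R. 1 * (grad_perp G (apar U \<tau> k) R \<bullet> grad_perp G (apar U \<tau> k) R)))"
    by (simp add: W_B_def[abs_def] conf_int_def power2_norm_eq_inner sum_divide_distrib)
  with DERIV_cmult[OF form(2), of "1 / (2 * mu0 S)"]
  have "(W_B S U has_real_derivative 1 / (2 * mu0 S) * (2 * ?b (dt (apar U) t))) (at t)" by simp
  moreover have "1 / (2 * mu0 S) * (2 * ?b (dt (apar U) t)) = ?J (dt (apar U) t)"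
    unfolding b using mu0_pos by simp
  ultimately show ?thesis by metis
qed

text \<open>With the Hamiltonian frozen at \<open>t\<close>, the kinetic part loses exactly the work
  on the current that \<open>W_B\<close> gains, and the remaining potential terms are
  stationary.\<close>

lemma energy_conserved:
  assumes t: "t \<in> T"
  shows "(W_total S U has_real_derivative 0) (at t)"
proof -
  let ?K = "\<lambda>\<tau>. \<Sum>s\<in>UNIV. \<Sum>j\<in>phase_idxs M. cell_int M (mass S s) j (\<lambda>z. Jf S U s \<tau> j z * ham S U s t j z)"
  let ?J = "conf_int M (\<lambda>k R. dt (apar U) t k R * J_par S U t k R)"
  let ?P = "conf_int M (\<lambda>k R. eps_perp S R * (grad_perp G (dt (pot U) t k) R \<bullet> grad_perp G (pot U t k) R))"
  have form: "((\<lambda>\<tau>. pot_form \<tau> t) has_real_derivative ?P) (at t)"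
    "((\<lambda>\<tau>. pot_form \<tau> \<tau>) has_real_derivative 2 * ?P) (at t)"
    by (rule gradient_form_deriv[OF t, where w = "eps_perp S" and F = "pot U"];
        simp add: pot_poly continuous_geometry(5) differentiable_in_time(2)[OF t])+
  have "(?K has_real_derivative (\<Sum>s\<in>UNIV. \<Sum>j\<in>phase_idxs M.
      cell_int M (mass S s) j (\<lambda>z. ham S U s t j z * dt (Jf S U s) t j z))) (at t)"
    by (intro DERIV_sum kinetic_deriv t real_polynomial_function_continuous_on space_polynomials)
  also have "(\<Sum>s\<in>UNIV. \<Sum>j\<in>phase_idxs M.
      cell_int M (mass S s) j (\<lambda>z. ham S U s t j z * dt (Jf S U s) t j z)) = - ?J"
    using current_work[of t "dt (apar U) t", OF t continuous_dt_apar[OF t]]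
    by (simp add: species_energy[OF t] sum_negf del: times_divide_eq_left)
  finally have K: "(?K has_real_derivative - ?J) (at t)" .
  \<comment> \<open>Half of the doubled derivative of the diagonal cancels the derivative with one
    argument frozen.\<close>
  have "((\<lambda>\<tau>. 1 / 2 * pot_form \<tau> \<tau> - pot_form \<tau> t) has_real_derivative 0) (at t)"
    using DERIV_diff[OF DERIV_cmult[OF form(2), of "1 / 2"] form(1)] by simp
  from DERIV_add[OF DERIV_add[OF K this] W_B_deriv[OF t]]
  have "((\<lambda>\<tau>. ?K \<tau> + (1 / 2 * pot_form \<tau> \<tau> - pot_form \<tau> t) + W_B S U \<tau>) has_real_derivative 0) (at t)"
    by simp
  then show ?thesis
    by (rule has_field_derivative_transform_within_open[OF _ T_open t])
       (simp only: W_total_def energy_splitting[OF t])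
qed

end

theorem proposition2:
  fixes S :: "'s::finite gk_setup" and U :: "'s gk_state" and T :: "real set"
  assumes "valid_mesh (grid S)"
    and "valid_geometry (grid S) (geom S)"
    and "1 \<le> deg S"
    and "valid_species S"
    and "0 < mu0 S"
    and "vpar_sq_projection (grid S) (deg S) (vpar_sq S)"
    and "Bdisc S \<in> X_cont (grid S) (deg S)"
    and "z_smoothing (grid S) (deg S) (Pz S)"
    and "z_adjoint (grid S) (deg S) (Pz S) (Pz_adj S)"
    and "open T" and "is_interval T"
    and "\<And>s t. t \<in> T \<Longrightarrow> dist_fn U s t \<in> V_space (grid S) (deg S)"
    and "\<And>t. t \<in> T \<Longrightarrow> pot U t \<in> X_cont_xy (grid S) (deg S)"
    and "\<And>t. t \<in> T \<Longrightarrow> Pz S (pot U t) \<in> X_cont (grid S) (deg S)"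
    and "\<And>t. t \<in> T \<Longrightarrow> apar U t \<in> X_cont_xy (grid S) (deg S)"
    and "C1_in_time S U T"
    and characteristics_normal_continuous:
      "\<And>s t d. t \<in> T \<Longrightarrow> cont_dir (grid S) d (charac S U s t d)"
    and upwind_flow_single_valued:
      "\<And>s t d. t \<in> T \<Longrightarrow> cont_dir (grid S) d (upw U s t d)"
    and "\<And>s t. t \<in> T \<Longrightarrow> dg_equation S U s t"
    and "\<And>t. t \<in> T \<Longrightarrow> poisson_equation S U t"
    and "\<And>t. t \<in> T \<Longrightarrow> ampere_equation S U t"
  shows "\<forall>t\<in>T. (W_total S U has_real_derivative 0) (at t)"
proof -
  have "vpar_sq S \<in> V_cont (grid S) (deg S)"
    using assms(6) by (simp add: vpar_sq_projection_def)
  then interpret dg_solution S U T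
    using assms by unfold_locales
  show ?thesis using energy_conserved by blast
qed

end
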